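(* For $n\ge 4$, the polytope $\mathsf{F(n)}$ has $2^{n-1}$ vertices, $2^{n-2}(2n-3)$ edges, and $(n^2-3n+12)/2$ facets.
   Context: $\mathsf{F(n)}$ is the set of $x\in\mathbb{R}^n$ satisfying $x_1\ge x_2\ge\cdots\ge x_n$ and $\sum_{i=1}^k x_i-\sum_{i=n-l+1}^n x_i\le k(n-1-l)$ for all integers $k,l\ge 0$ with $1\le k+l\le n$. *)

theory Defs
  imports "HOL-Analysis.Analysis"
begin

text \<open>
  The dimension \<open>n\<close> is \<open>CARD('n)\<close>. As the index type \<open>'n\<close> carries no order, the coordinates are
  labelled by an enumeration \<open>e\<close> of \<open>'n\<close>, intended to be a bijection from \<open>{1..CARD('n)}\<close> onto
  \<open>UNIV\<close>: the coordinate \<open>x_i\<close> is \<open>x $ e i\<close>. The bound \<open>k * (n - 1 - l)\<close> is computed over the reals,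
  since \<open>n - 1 - l\<close> is negative for \<open>l = n\<close>.
\<close>

definition F_polytope :: "(nat \<Rightarrow> 'n::finite) \<Rightarrow> (real ^ 'n) set" where
  "F_polytope e =
    {x. (\<forall>i. 1 \<le> i \<and> i < CARD('n) \<longrightarrow> x $ e i \<ge> x $ e (i + 1)) \<and>
        (\<forall>k l. 1 \<le> k + l \<and> k + l \<le> CARD('n) \<longrightarrow>
           (\<Sum>i = 1..k. x $ e i) - (\<Sum>i = CARD('n) - l + 1..CARD('n). x $ e i)
             \<le> real k * (real CARD('n) - 1 - real l))}"

end

theory Submission
  imports Defs
begin

text \<open>
  Write \<open>slack n x k l\<close> for the slack of the inequality with parameters \<open>k, l\<close>. Both faces \<open>x_n = 0\<close> and
  \<open>x_1 = n - 1\<close> of \<open>F(n)\<close> are copies of \<open>F(n - 1)\<close>. If \<open>x\<close> lies on neither, let \<open>K\<close> and \<open>L\<close> be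
  the sets of the \<open>k\<close> first and \<open>l\<close> last positions on which \<open>x\<close> takes its extreme values. Every inequality
  \<open>(i, j)\<close> that is tight at \<open>x\<close> has \<open>i \<ge> k\<close> and \<open>j \<ge> l\<close>, so \<open>x\<close> can be moved both ways along
  \<open>l 1_K + k 1_L\<close> (along \<open>1\<close> if \<open>x\<close> is constant). Hence the vertices of \<open>F(n)\<close> are those of the two
  disjoint faces, and an edge contained in neither of them is parallel to such a direction. These crossing edges
  are the segments from \<open>v\<close> to \<open>v + l 1_K + k 1_L\<close>, where \<open>v\<close> is a vertex with \<open>v = 0\<close> on \<open>L\<close> and
  \<open>v = n - 1 - l\<close> on \<open>K\<close>, together with the segment from \<open>0\<close> to \<open>n - 1\<close>. There are \<open>2 ^ (n - 1)\<close> of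
  them for \<open>n \<ge> 3\<close>, which gives the recursion for the number of edges.

  The facets are counted from an irredundant system of inequalities: the monotonicity conditions and the pairs
  \<open>(k, l)\<close> with \<open>k + l = 1\<close>, or with \<open>k, l \<ge> 1\<close> and \<open>k + l = n\<close> or \<open>k + l \<le> n - 3\<close>.
\<close>

section \<open>Slacks and peeling\<close>

definition slack :: "nat \<Rightarrow> (nat \<Rightarrow> real) \<Rightarrow> nat \<Rightarrow> nat \<Rightarrow> real" where
  "slack m s k l = real k * (real m - 1 - real l) - (\<Sum>i = 1..k. s i) + (\<Sum>i = m - l + 1..m. s i)"

text \<open>\<open>EG\<close> stands for Erdos-Gallai.\<close>

definition EG :: "nat \<Rightarrow> (nat \<Rightarrow> real) \<Rightarrow> bool" where
  "EG m s \<longleftrightarrow> (\<forall>t. 1 \<le> t \<and> t < m \<longrightarrow> s (Suc t) \<le> s t) \<and> (\<forall>k l. k + l \<le> m \<longrightarrow> 0 \<le> slack m s k l)"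

lemma slack_0_0 [simp]: "slack m s 0 0 = 0"
  by (simp add: slack_def)

lemma slack_Suc_left: "slack m s (Suc k) l = slack m s k l + (real m - 1 - real l) - s (Suc k)"
  by (simp add: slack_def algebra_simps)

lemma slack_Suc_right:
  assumes "l < m"
  shows "slack m s k (Suc l) = slack m s k l + s (m - l) - real k"
proof -
  have "{m - Suc l + 1..m} = insert (m - l) {m - l + 1..m}"
    using assms by auto
  then show ?thesis
    by (simp add: slack_def algebra_simps)
qed

lemma slack_cong:
  assumes "\<And>t. t \<in> {1..m} \<Longrightarrow> s t = r t" "k + l \<le> m"
  shows "slack m s k l = slack m r k l"
proof -
  have "sum s {1..k} = sum r {1..k}" "sum s {m - l + 1..m} = sum r {m - l + 1..m}"
    using assms by (auto intro!: sum.cong)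
  then show ?thesis by (simp add: slack_def)
qed

lemma EG_cong:
  assumes "\<And>t. t \<in> {1..m} \<Longrightarrow> s t = r t"
  shows "EG m s \<longleftrightarrow> EG m r"
  using assms slack_cong[of m s r] by (auto simp: EG_def)

lemma EG_slack: "EG m s \<Longrightarrow> k + l \<le> m \<Longrightarrow> 0 \<le> slack m s k l"
  by (auto simp: EG_def)

lemma EG_mono:
  assumes "EG m s" "1 \<le> i" "i \<le> j" "j \<le> m"
  shows "s j \<le> s i"
  using assms(3,4)
proof (induction j rule: dec_induct)
  case (step n)
  then have "s (Suc n) \<le> s n"
    using assms(1,2) by (simp add: EG_def)
  with step show ?case by simp
qed simp

lemma EG_first: "EG m s \<Longrightarrow> 1 \<le> m \<Longrightarrow> s 1 \<le> real m - 1"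
  using EG_slack[of m s 1 0] by (simp add: slack_def)

lemma EG_last: "EG m s \<Longrightarrow> 1 \<le> m \<Longrightarrow> 0 \<le> s m"
  using EG_slack[of m s 0 1] by (simp add: slack_def)

lemma EG_first_last: "EG m s \<Longrightarrow> 2 \<le> m \<Longrightarrow> s 1 - s m \<le> real m - 2"
  using EG_slack[of m s 1 1] by (simp add: slack_def)

text \<open>The factor \<open>m - 1 - l\<close> does not change when \<open>m\<close> and
  \<open>l\<close> both grow by one, so a further trailing entry contributes only its own
  value.\<close>

lemma slack_peel_last: "slack (Suc m) s k (Suc l) = slack m s k l + s (Suc m)"
proof -
  have "{Suc m - Suc l + 1..Suc m} = insert (Suc m) {m - l + 1..m}"
    by auto
  then show ?thesis by (simp add: slack_def)
qed

text \<open>In terms of degrees, a first vertex joined to all others adds one to every remaining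
  entry; deleting it lowers them by one, and \<open>real m - s 1\<close> is what it lacks of full
  degree.\<close>

lemma slack_peel_first:
  assumes "l \<le> m"
  shows "slack (Suc m) s (Suc k) l = slack m (\<lambda>t. s (Suc t) - 1) k l + real m - s 1"
proof -
  define P where "P = (\<Sum>i = 1..k. s (Suc i))"
  define R where "R = (\<Sum>i = m - l + 1..m. s (Suc i))"
  have 1: "(\<Sum>i = 1..Suc k. s i) = s 1 + P"
    unfolding P_def by (induction k) auto
  have 2: "(\<Sum>i = Suc m - l + 1..Suc m. s i) = R"
    unfolding R_def
    using assms sum.shift_bounds_cl_Suc_ivl[of s "m - l + 1" m] by (simp add: Suc_diff_le)
  have 3: "(\<Sum>i = 1..k. s (Suc i) - 1) = P - real k"
    unfolding P_def sum_subtractf by simp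
  have 4: "(\<Sum>i = m - l + 1..m. s (Suc i) - 1) = R - real l"
    unfolding R_def sum_subtractf using assms by simp
  show ?thesis
    unfolding slack_def 1 2 3 4 by (simp add: algebra_simps)
qed

text \<open>The inequalities with \<open>l \<ge> 1\<close> shift to those of the shorter sequence.
  Those with \<open>l = 0\<close> do not, and follow from the bound \<open>m - 1\<close> on its
  entries.\<close>

lemma EG_peel_last:
  assumes "s (Suc m) = 0"
  shows "EG (Suc m) s \<longleftrightarrow> EG m s"
proof
  assume E: "EG (Suc m) s"
  show "EG m s"
    unfolding EG_def
  proof (intro conjI allI impI)
    show "0 \<le> slack m s k l" if "k + l \<le> m" for k l
      using EG_slack[OF E, of k "Suc l"] that assms by (simp add: slack_peel_last)
  qed (use E in \<open>auto simp: EG_def\<close>)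
next
  assume E: "EG m s"
  have nn: "0 \<le> s t" if "1 \<le> t" "t \<le> m" for t
    using EG_last[OF E] EG_mono[OF E, of t m] that by auto
  have le: "s t \<le> real m - 1" if "1 \<le> t" "t \<le> m" for t
    using EG_first[OF E] EG_mono[OF E, of 1 t] that by auto
  have "sum s {1..k} \<le> real k * real m" if "k \<le> Suc m" for k
  proof -
    have "s t \<le> real m" if "t \<in> {1..k}" for t
      using that \<open>k \<le> Suc m\<close> le[of t] assms by (cases "t = Suc m") auto
    then show ?thesis
      using sum_bounded_above[of "{1..k}" s "real m"] by auto
  qed
  then have "0 \<le> slack (Suc m) s k 0" if "k \<le> Suc m" for k
    using that by (simp add: slack_def)
  moreover have "0 \<le> slack (Suc m) s k (Suc l)" if "k + Suc l \<le> Suc m" for k l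
    using EG_slack[OF E, of k l] that assms by (simp add: slack_peel_last)
  ultimately have "0 \<le> slack (Suc m) s k l" if "k + l \<le> Suc m" for k l
    using that by (cases l) auto
  moreover have "s (Suc t) \<le> s t" if "1 \<le> t" "t < Suc m" for t
    using E nn[of t] that assms by (cases "t = m") (auto simp: EG_def)
  ultimately show "EG (Suc m) s"
    unfolding EG_def by blast
qed

text \<open>Mirror image of peeling a last \<open>0\<close>: here the inequalities with
  \<open>k = 0\<close> do not shift, and they follow from nonnegativity of the entries.\<close>

lemma EG_peel_first:
  assumes "s 1 = real m"
  shows "EG (Suc m) s \<longleftrightarrow> EG m (\<lambda>t. s (Suc t) - 1)"
proof
  assume E: "EG (Suc m) s"
  show "EG m (\<lambda>t. s (Suc t) - 1)"
    unfolding EG_def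
  proof (intro conjI allI impI)
    show "0 \<le> slack m (\<lambda>t. s (Suc t) - 1) k l" if "k + l \<le> m" for k l
      using EG_slack[OF E, of "Suc k" l] that assms by (simp add: slack_peel_first)
  qed (use E in \<open>auto simp: EG_def\<close>)
next
  assume E: "EG m (\<lambda>t. s (Suc t) - 1)"
  have nn: "1 \<le> s t" if nnt: "2 \<le> t" "t \<le> Suc m" for t
  proof -
    obtain u where "t = Suc u" "1 \<le> u" "u \<le> m" using nnt by (cases t) force+
    then show ?thesis using EG_last[OF E] EG_mono[OF E, of u m] by auto
  qed
  have "0 \<le> slack (Suc m) s 0 l" if "l \<le> Suc m" for l
  proof -
    have "0 \<le> s t" if "t \<in> {Suc m - l + 1..Suc m}" for t
      using that nn[of t] assms by (cases "t = 1") auto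
    then have "0 \<le> (\<Sum>i = Suc m - l + 1..Suc m. s i)" by (rule sum_nonneg)
    then show ?thesis by (simp add: slack_def)
  qed
  moreover have "0 \<le> slack (Suc m) s (Suc k) l" if "Suc k + l \<le> Suc m" for k l
    using EG_slack[OF E, of k l] that assms by (simp add: slack_peel_first)
  ultimately have "0 \<le> slack (Suc m) s k l" if "k + l \<le> Suc m" for k l
    using that by (cases k) auto
  moreover have "s (Suc t) \<le> s t" if t: "1 \<le> t" "t < Suc m" for t
  proof (cases "t = 1")
    case True
    then show ?thesis using EG_first[OF E] t assms by simp
  next
    case False
    then obtain t' where "t = Suc t'" "1 \<le> t'" "t' < m"
      using t by (cases t) auto
    then show ?thesis using E by (auto simp: EG_def)
  qed
  ultimately show "EG (Suc m) s"
    unfolding EG_def by blast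
qed

lemma EG_peel_lasts:
  assumes "l \<le> m" "\<And>t. t \<in> {m - l + 1..m} \<Longrightarrow> s t = 0"
  shows "EG m s \<longleftrightarrow> EG (m - l) s"
  using assms
proof (induction l)
  case (Suc l)
  then obtain j where j: "m - l = Suc j" by (cases "m - l") auto
  then have "m - Suc l = j" by simp
  moreover have "EG (Suc j) s \<longleftrightarrow> EG j s"
  proof (rule EG_peel_last, rule Suc.prems(2))
    show "Suc j \<in> {m - Suc l + 1..m}" using Suc.prems(1) j by simp linarith
  qed
  moreover have "EG m s \<longleftrightarrow> EG (m - l) s"
    using Suc.prems by (intro Suc.IH) auto
  ultimately show ?case using j by simp
qed simp

text \<open>Each peeled entry lowers the greatest possible value and the remaining entries by one,
  so the value \<open>real m - 1\<close> stays extreme at every stage.\<close>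

lemma EG_peel_firsts:
  assumes "k \<le> m" "\<And>t. t \<in> {1..k} \<Longrightarrow> s t = real m - 1"
  shows "EG m s \<longleftrightarrow> EG (m - k) (\<lambda>t. s (t + k) - real k)"
  using assms
proof (induction k)
  case (Suc k)
  then obtain j where j: "m - k = Suc j" by (cases "m - k") auto
  then have mj: "m - Suc k = j" "real m = real j + real k + 1" by auto
  have "EG (Suc j) (\<lambda>t. s (t + k) - real k) \<longleftrightarrow> EG j (\<lambda>t. s (Suc t + k) - real k - 1)"
    using Suc.prems mj by (intro EG_peel_first) auto
  moreover have "EG m s \<longleftrightarrow> EG (m - k) (\<lambda>t. s (t + k) - real k)"
    using Suc.prems by (intro Suc.IH) auto
  moreover have "(\<lambda>t. s (Suc t + k) - real k - 1) = (\<lambda>t. s (t + Suc k) - real (Suc k))"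
    by auto
  ultimately show ?case using j mj by simp
qed simp

section \<open>Tight inequalities away from the two faces\<close>

text \<open>For fixed \<open>j\<close> the slack is affine in \<open>i\<close> up to
  \<open>k\<close>, with value \<open>T\<close> at \<open>0\<close>. If \<open>T\<close> is positive
  and the slack vanishes at \<open>i\<close>, the slope is negative and \<open>(i + 1, j)\<close>,
  admissible by \<open>i + j < m\<close>, would be violated. For \<open>j = 0\<close> the slope
  itself is positive.\<close>

lemma slack_tight_left:
  assumes E: "EG m s" and nc: "0 < s m" "s 1 < real m - 1"
    and K: "\<And>t. t \<in> {1..k} \<Longrightarrow> s t = s 1" and km: "k \<le> m"
    and kl: "1 \<le> i + j" "i + j < m" "i < k"
  shows "slack m s i j \<noteq> 0"
proof
  assume 0: "slack m s i j = 0"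
  define T where "T = (\<Sum>t = m - j + 1..m. s t)"
  define d where "d = real m - 1 - real j - s 1"
  have *: "slack m s i' j = real i' * d + T" if "i' \<le> k" for i'
  proof -
    have "(\<Sum>t = 1..i'. s t) = (\<Sum>t = 1..i'. s 1)"
      by (rule sum.cong[OF refl], rule K, use that in simp)
    then show ?thesis by (simp add: slack_def T_def d_def algebra_simps)
  qed
  have i: "real i * d + T = 0" "0 \<le> real (Suc i) * d + T"
    using *[of i] *[of "Suc i"] 0 EG_slack[OF E, of "Suc i" j] kl by auto
  have T: "0 < T" if "1 \<le> j"
    unfolding T_def
  proof (intro sum_pos)
    show "0 < s t" if "t \<in> {m - j + 1..m}" for t
      using EG_mono[OF E, of t m] that nc by auto
  qed (use that kl in auto)
  show False
  proof (cases "j = 0")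
    case True
    then have "T = 0" "0 < d" "1 \<le> i"
      using nc kl by (auto simp: T_def d_def)
    then show False using i by auto
  next
    case False
    then have "0 < T" using T by simp
    then have "real i * d < 0" using i(1) by linarith
    then have "d < 0" by (simp add: mult_less_0_iff)
    then show False using i by (simp add: algebra_simps)
  qed
qed

text \<open>The same argument with fixed \<open>i\<close>, where the slack is affine in
  \<open>j\<close> up to \<open>l\<close>.\<close>

lemma slack_tight_right:
  assumes E: "EG m s" and nc: "0 < s m" "s 1 < real m - 1"
    and L: "\<And>t. t \<in> {m - l + 1..m} \<Longrightarrow> s t = s m" and lm: "l \<le> m"
    and kl: "1 \<le> i + j" "i + j < m" "j < l"
  shows "slack m s i j \<noteq> 0"
proof
  assume 0: "slack m s i j = 0"
  define T where "T = real i * (real m - 1) - (\<Sum>t = 1..i. s t)"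
  define d where "d = s m - real i"
  have *: "slack m s i j' = real j' * d + T" if "j' \<le> l" for j'
  proof -
    have "s t = s m" if "t \<in> {m - j' + 1..m}" for t
      by (rule L) (use that \<open>j' \<le> l\<close> in auto)
    then have "(\<Sum>t = m - j' + 1..m. s t) = real (card {m - j' + 1..m}) * s m"
      by (metis (no_types, lifting) sum.cong sum_constant)
    also have "\<dots> = real j' * s m"
      using that lm by simp
    finally show ?thesis
      by (simp add: slack_def T_def d_def algebra_simps)
  qed
  have i: "real j * d + T = 0" "0 \<le> real (Suc j) * d + T"
    using *[of j] *[of "Suc j"] 0 EG_slack[OF E, of i "Suc j"] kl by auto
  have T: "0 < T" if "1 \<le> i"
  proof -
    have "0 < (\<Sum>t = 1..i. (real m - 1) - s t)"
    proof (intro sum_pos)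
      show "0 < (real m - 1) - s t" if "t \<in> {1..i}" for t
        using EG_mono[OF E, of 1 t] that nc kl by auto
    qed (use that kl in auto)
    then show ?thesis unfolding T_def sum_subtractf by (simp add: algebra_simps)
  qed
  show False
  proof (cases "i = 0")
    case True
    then have "T = 0" "0 < d" "1 \<le> j"
      using nc kl by (auto simp: T_def d_def)
    then show False using i by auto
  next
    case False
    then have "0 < T" using T by simp
    then have "real j * d < 0" using i(1) by linarith
    then have "d < 0" by (simp add: mult_less_0_iff)
    then show False using i by (simp add: algebra_simps)
  qed
qed

text \<open>Diagonal pairs have no larger admissible neighbour to compare with. This identity links
  them to pairs of sum \<open>m - 2\<close>: tightness passes down as soon as the two entries
  agree.\<close>

lemma slack_diagonal:
  assumes "Suc i + Suc j = m"
  shows "slack m s (Suc i) (Suc j) = slack m s i j - (s (Suc i) - s (Suc (Suc i)))"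
proof -
  have "m - j = Suc (Suc i)" "real m = real i + real j + 2" using assms by auto
  then show ?thesis using assms by (simp add: slack_Suc_left slack_Suc_right)
qed

text \<open>At \<open>(0, m)\<close> and \<open>(m, 0)\<close> the slack is the sum of the entries,
  respectively of their distances from \<open>m - 1\<close>, and all of these are positive.\<close>

lemma slack_tight_diagonal:
  assumes E: "EG m s" and nc: "0 < s m" "s 1 < real m - 1" and "i + j = m"
    and "slack m s i j = 0"
  and "1 \<le> m" shows "1 \<le> i \<and> 1 \<le> j"
proof -
  have "0 < slack m s 0 m" if "1 \<le> m"
  proof -
    have "0 < (\<Sum>t = 1..m. s t)"
    proof (intro sum_pos)
      show "0 < s t" if "t \<in> {1..m}" for t
        using EG_mono[OF E, of t m] that nc by auto
    qed (use that in auto)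
    then show ?thesis by (simp add: slack_def)
  qed
  moreover have "0 < slack m s m 0" if "1 \<le> m"
  proof -
    have "0 < (\<Sum>t = 1..m. (real m - 1) - s t)"
    proof (intro sum_pos)
      show "0 < (real m - 1) - s t" if "t \<in> {1..m}" for t
        using EG_mono[OF E, of 1 t] that nc by auto
    qed (use that in auto)
    then show ?thesis unfolding sum_subtractf by (simp add: slack_def algebra_simps)
  qed
  ultimately show ?thesis
    using assms(4-6) by (cases "i = 0"; cases "j = 0") auto
qed

section \<open>Moving along the extreme level sets\<close>

lemma finite_common_step:
  fixes a b :: "'i \<Rightarrow> real"
  assumes "finite I" "\<And>i. i \<in> I \<Longrightarrow> 0 \<le> a i" "\<And>i. i \<in> I \<Longrightarrow> a i = 0 \<Longrightarrow> b i = 0"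
  shows "\<exists>\<epsilon>>0. \<forall>i\<in>I. \<epsilon> * \<bar>b i\<bar> \<le> a i"
  using assms
proof (induction I)
  case empty
  then show ?case by (auto intro: exI[of _ 1])
next
  case (insert i I)
  then obtain \<epsilon> where \<epsilon>: "\<epsilon> > 0" "\<And>j. j \<in> I \<Longrightarrow> \<epsilon> * \<bar>b j\<bar> \<le> a j"
    by auto
  obtain \<eta> where \<eta>: "\<eta> > 0" "\<eta> * \<bar>b i\<bar> \<le> a i"
  proof (cases "b i = 0")
    case True
    then show ?thesis using insert.prems by (intro that[of 1]) auto
  next
    case False
    then have "a i > 0" using insert.prems by (metis insertI1 less_eq_real_def)
    then show ?thesis using False by (intro that[of "a i / \<bar>b i\<bar>"]) auto
  qed
  have "min \<epsilon> \<eta> * \<bar>b j\<bar> \<le> a j" if "j \<in> insert i I" for j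
  proof -
    have "min \<epsilon> \<eta> * \<bar>b j\<bar> \<le> \<epsilon> * \<bar>b j\<bar>" "min \<epsilon> \<eta> * \<bar>b j\<bar> \<le> \<eta> * \<bar>b j\<bar>"
      by (auto intro: mult_right_mono)
    then show ?thesis using that \<epsilon>(2)[of j] \<eta>(2) by fastforce
  qed
  then show ?case using \<epsilon>(1) \<eta>(1) by (intro exI[of _ "min \<epsilon> \<eta>"]) auto
qed

lemma slack_add_scaled:
  "slack m (\<lambda>t. s t + u * d t) k l =
    slack m s k l - u * ((\<Sum>t = 1..k. d t) - (\<Sum>t = m - l + 1..m. d t))"
  by (simp add: slack_def sum.distrib sum_distrib_left[symmetric] algebra_simps)

text \<open>Tight constraints stay equalities along \<open>d\<close>, and each of the finitely many
  strict ones tolerates a small step; \<open>finite_common_step\<close> provides one size for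
  all.\<close>

lemma EG_two_sided_step:
  assumes E: "EG m s"
    and mono: "\<And>t. 1 \<le> t \<Longrightarrow> t < m \<Longrightarrow> s (Suc t) = s t \<Longrightarrow> d (Suc t) = d t"
    and tight: "\<And>k l. k + l \<le> m \<Longrightarrow> slack m s k l = 0 \<Longrightarrow>
      (\<Sum>t = 1..k. d t) = (\<Sum>t = m - l + 1..m. d t)"
  shows "\<exists>\<epsilon>>0. EG m (\<lambda>t. s t + \<epsilon> * d t) \<and> EG m (\<lambda>t. s t + (-\<epsilon>) * d t)"
proof -
  define D where "D k l = (\<Sum>t = 1..k. d t) - (\<Sum>t = m - l + 1..m. d t)" for k l
  have "\<exists>\<epsilon>>0. \<forall>t\<in>{1..<m}. \<epsilon> * \<bar>d t - d (Suc t)\<bar> \<le> s t - s (Suc t)"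
    using E mono by (intro finite_common_step) (auto simp: EG_def)
  then obtain \<epsilon>1 where 1: "\<epsilon>1 > 0"
      "\<And>t. 1 \<le> t \<Longrightarrow> t < m \<Longrightarrow> \<epsilon>1 * \<bar>d t - d (Suc t)\<bar> \<le> s t - s (Suc t)"
    by auto
  have "finite {p. fst p + snd p \<le> m}"
    by (rule finite_subset[of _ "{..m} \<times> {..m}"]) auto
  then have "\<exists>\<epsilon>>0. \<forall>p\<in>{p. fst p + snd p \<le> m}.
      \<epsilon> * \<bar>D (fst p) (snd p)\<bar> \<le> slack m s (fst p) (snd p)"
    using EG_slack[OF E] tight by (intro finite_common_step) (auto simp: D_def)
  then obtain \<epsilon>2 where 2: "\<epsilon>2 > 0" "\<And>k l. k + l \<le> m \<Longrightarrow> \<epsilon>2 * \<bar>D k l\<bar> \<le> slack m s k l"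
    by auto
  define \<epsilon> where "\<epsilon> = min \<epsilon>1 \<epsilon>2"
  have "EG m (\<lambda>t. s t + u * d t)" if u: "\<bar>u\<bar> = \<epsilon>" for u
    unfolding EG_def
  proof (intro conjI allI impI)
    fix t assume t: "1 \<le> t \<and> t < m"
    have "u * (d (Suc t) - d t) \<le> \<bar>u\<bar> * \<bar>d t - d (Suc t)\<bar>"
      by (metis abs_ge_self abs_minus_commute abs_mult)
    also have "\<dots> \<le> \<epsilon>1 * \<bar>d t - d (Suc t)\<bar>"
      unfolding u \<epsilon>_def by (rule mult_right_mono) auto
    also have "\<dots> \<le> s t - s (Suc t)" using 1 t by simp
    finally show "s (Suc t) + u * d (Suc t) \<le> s t + u * d t" by (simp add: algebra_simps)
  next
    fix k l assume kl: "k + l \<le> m"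
    have "u * D k l \<le> \<bar>u\<bar> * \<bar>D k l\<bar>"
      by (metis abs_ge_self abs_mult)
    also have "\<dots> \<le> \<epsilon>2 * \<bar>D k l\<bar>"
      unfolding u \<epsilon>_def by (rule mult_right_mono) auto
    also have "\<dots> \<le> slack m s k l" using 2 kl by simp
    finally show "0 \<le> slack m (\<lambda>t. s t + u * d t) k l"
      unfolding slack_add_scaled D_def by simp
  qed
  moreover have "\<epsilon> > 0" using 1 2 by (simp add: \<epsilon>_def)
  ultimately show ?thesis
    by (metis abs_minus_cancel abs_of_pos)
qed

text \<open>The values \<open>l\<close> and \<open>k\<close> balance the two blocks: both have sum
  \<open>k * l\<close>, so the slack of every admissible pair \<open>(i, j)\<close> with
  \<open>i \<ge> k\<close> and \<open>j \<ge> l\<close> is constant along this direction.\<close>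

definition block_dir :: "nat \<Rightarrow> nat \<Rightarrow> nat \<Rightarrow> nat \<Rightarrow> real" where
  "block_dir m k l t = (if t \<le> k then real l else if m - l < t then real k else 0)"

lemma sum_block_dir_left:
  assumes "k \<le> i" "i + l \<le> m"
  shows "(\<Sum>t = 1..i. block_dir m k l t) = real k * real l"
proof -
  have "(\<Sum>t = 1..i. block_dir m k l t) = (\<Sum>t = 1..k. block_dir m k l t)"
    using assms by (intro sum.mono_neutral_right) (auto simp: block_dir_def)
  also have "\<dots> = (\<Sum>t = 1..k. real l)"
    by (intro sum.cong) (auto simp: block_dir_def)
  finally show ?thesis by simp
qed

lemma sum_block_dir_right:
  assumes "l \<le> j" "k + j \<le> m"
  shows "(\<Sum>t = m - j + 1..m. block_dir m k l t) = real k * real l"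
proof -
  have "(\<Sum>t = m - j + 1..m. block_dir m k l t) = (\<Sum>t = m - l + 1..m. block_dir m k l t)"
    using assms by (intro sum.mono_neutral_right) (auto simp: block_dir_def)
  also have "\<dots> = (\<Sum>t = m - l + 1..m. real k)"
    using assms by (intro sum.cong) (auto simp: block_dir_def)
  also have "\<dots> = real (card {m - l + 1..m}) * real k"
    by (rule sum_constant)
  finally show ?thesis using assms by simp
qed

lemma first_level_set:
  assumes E: "EG m s" and "1 \<le> m"
  obtains k where "1 \<le> k" "k \<le> m" "\<And>t. t \<in> {1..k} \<Longrightarrow> s t = s 1" "k < m \<Longrightarrow> s (Suc k) < s 1"
proof -
  define K where "K = {t \<in> {1..m}. s t = s 1}"
  have K: "finite K" "1 \<in> K" using assms by (auto simp: K_def)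
  define k where "k = Max K"
  have k: "k \<in> K" "1 \<le> k" unfolding k_def using K Max_in[of K] Max_ge[of K 1] by blast+
  show ?thesis
  proof (rule that[of k])
    show "s t = s 1" if "t \<in> {1..k}" for t
      using k that EG_mono[OF E, of 1 t] EG_mono[OF E, of t k] by (auto simp: K_def)
    show "s (Suc k) < s 1" if "k < m"
    proof -
      have "Suc k \<notin> K" using Max_ge[OF K(1), of "Suc k", folded k_def] by auto
      then show ?thesis using that EG_mono[OF E, of 1 "Suc k"] by (auto simp: K_def)
    qed
  qed (use k in \<open>auto simp: K_def\<close>)
qed

lemma last_level_set:
  assumes E: "EG m s" and "1 \<le> m"
  obtains l where "1 \<le> l" "l \<le> m" "\<And>t. t \<in> {m - l + 1..m} \<Longrightarrow> s t = s m"
    "l < m \<Longrightarrow> s m < s (m - l)"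
proof -
  define L where "L = {t \<in> {1..m}. s t = s m}"
  have L: "finite L" "m \<in> L" using assms by (auto simp: L_def)
  define p where "p = Min L"
  have p: "p \<in> L" "p \<le> m" unfolding p_def using L Min_in[of L] Min_le[of L m] by blast+
  then have pm: "1 \<le> p" by (auto simp: L_def)
  show ?thesis
  proof (rule that[of "m + 1 - p"])
    show "s t = s m" if "t \<in> {m - (m + 1 - p) + 1..m}" for t
      using p pm that EG_mono[OF E, of p t] EG_mono[OF E, of t m] by (auto simp: L_def)
    show "s m < s (m - (m + 1 - p))" if "m + 1 - p < m"
    proof -
      have "p - 1 \<notin> L" using Min_le[OF L(1), of "p - 1", folded p_def] pm by auto
      moreover have "m - (m + 1 - p) = p - 1" "p - 1 \<in> {1..m}" using p that by auto
      ultimately show ?thesis using EG_mono[OF E, of "p - 1" m] by (auto simp: L_def)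
    qed
  qed (use p pm in auto)
qed

text \<open>The shape of the direction is recorded because it later determines the edges; for the
  vertices it is enough that the direction is nonzero.\<close>

lemma EG_move:
  assumes E: "EG m s" and m: "1 \<le> m" and nc: "0 < s m" "s 1 < real m - 1"
  obtains (blocks) k l \<epsilon> where "1 \<le> k" "1 \<le> l" "k + l \<le> m" "\<epsilon> > 0" "s 1 \<noteq> s m"
      "\<And>t. t \<in> {1..k} \<Longrightarrow> s t = s 1" "\<And>t. t \<in> {m - l + 1..m} \<Longrightarrow> s t = s m"
      "EG m (\<lambda>t. s t + \<epsilon> * block_dir m k l t)" "EG m (\<lambda>t. s t + (-\<epsilon>) * block_dir m k l t)"
    | (const) \<epsilon> where "\<epsilon> > 0" "\<And>t. t \<in> {1..m} \<Longrightarrow> s t = s 1"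
      "EG m (\<lambda>t. s t + \<epsilon> * 1)" "EG m (\<lambda>t. s t + (-\<epsilon>) * 1)"
proof (cases "s 1 = s m")
  case True
  have c: "s t = s 1" if "t \<in> {1..m}" for t
    using that True EG_mono[OF E, of 1 t] EG_mono[OF E, of t m] by auto
  have "\<exists>\<epsilon>>0. EG m (\<lambda>t. s t + \<epsilon> * 1) \<and> EG m (\<lambda>t. s t + (-\<epsilon>) * 1)"
  proof (rule EG_two_sided_step[OF E])
    fix i j assume ij: "i + j \<le> m" "slack m s i j = 0"
    have lt: "i' + j' = 0" if "i' + j' < m" "slack m s i' j' = 0" for i' j'
    proof (rule ccontr)
      assume "i' + j' \<noteq> 0"
      then have "1 \<le> i' + j'" "i' < m" using that by auto
      from slack_tight_left[OF E nc c order_refl this(1) that(1) this(2)] that(2)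
      show False by simp
    qed
    \<comment> \<open>Off the diagonal only \<open>(0, 0)\<close> is tight. On the diagonal,
      stepping down from a tight pair reaches \<open>(0, 0)\<close>, so the pair is
      \<open>(1, 1)\<close>.\<close>
    have "i = j"
    proof (cases "i + j < m")
      case True
      then show ?thesis using lt ij by fastforce
    next
      case False
      then have im: "i + j = m" using ij by simp
      then have "1 \<le> i" "1 \<le> j" using slack_tight_diagonal[OF E nc im ij(2) m] by auto
      then obtain i' j' where *: "i = Suc i'" "j = Suc j'" by (metis Suc_le_D One_nat_def)
      then have "s (Suc i') = s (Suc (Suc i'))"
        using c[of "Suc i'"] c[of "Suc (Suc i')"] im by simp
      then have "slack m s i' j' = 0"
        using slack_diagonal[of i' j' m s] ij im * by simp
      then have "i' + j' = 0" using lt[of i' j'] im * by simp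
      then show ?thesis using * by simp
    qed
    then show "(\<Sum>t = 1..i. 1) = (\<Sum>t = m - j + 1..m. 1::real)"
      using ij by simp
  qed auto
  then show thesis using const c by blast
next
  case False
  obtain k where k: "1 \<le> k" "k \<le> m" "\<And>t. t \<in> {1..k} \<Longrightarrow> s t = s 1" "k < m \<Longrightarrow> s (Suc k) < s 1"
    using first_level_set[OF E m] by blast
  obtain l where l: "1 \<le> l" "l \<le> m" "\<And>t. t \<in> {m - l + 1..m} \<Longrightarrow> s t = s m"
      "l < m \<Longrightarrow> s m < s (m - l)"
    using last_level_set[OF E m] by blast
  have kl: "k + l \<le> m"
  proof (rule ccontr)
    assume *: "\<not> k + l \<le> m"
    have "s k = s m" by (rule l(3)) (use * k(1,2) in auto)
    moreover have "s k = s 1" by (rule k(3)) (use k(1) in auto)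
    ultimately show False using False by simp
  qed
  have "\<exists>\<epsilon>>0. EG m (\<lambda>t. s t + \<epsilon> * block_dir m k l t) \<and> EG m (\<lambda>t. s t + (-\<epsilon>) * block_dir m k l t)"
  proof (rule EG_two_sided_step[OF E])
    fix t assume t: "1 \<le> t" "t < m" "s (Suc t) = s t"
    have "t \<noteq> k"
    proof
      assume "t = k"
      then have "s t = s 1" "s (Suc t) < s 1" using k(3)[of t] k(4) t by auto
      then show False using t by simp
    qed
    moreover have "t \<noteq> m - l"
    proof
      assume tl: "t = m - l"
      then have "Suc t \<in> {m - l + 1..m}" using t by auto
      then have "s (Suc t) = s m" by (rule l(3))
      moreover have "s m < s t" using l(1,4) t tl by simp
      ultimately show False using t by simp
    qed
    ultimately show "block_dir m k l (Suc t) = block_dir m k l t"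
      by (auto simp: block_dir_def)
  next
    fix i j assume ij: "i + j \<le> m" "slack m s i j = 0"
    have lt: "i' + j' = 0 \<or> (k \<le> i' \<and> l \<le> j')" if "i' + j' < m" "slack m s i' j' = 0" for i' j'
    proof (rule ccontr)
      assume *: "\<not> ?thesis"
      then have "1 \<le> i' + j'" by linarith
      then have "\<not> i' < k" "\<not> j' < l"
        using slack_tight_left[OF E nc k(3,2) _ that(1)] slack_tight_right[OF E nc l(3,2) _ that(1)] that(2)
        by blast+
      then show False using * by simp
    qed
    \<comment> \<open>A diagonal pair with \<open>i < k\<close> or \<open>j < l\<close> cuts through
      a level set, so the entries \<open>i\<close> and \<open>i + 1\<close> agree and
      \<open>(i - 1, j - 1)\<close> is tight too; that pair is covered by \<open>lt\<close>.\<close>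
    have "i + j = 0 \<or> (k \<le> i \<and> l \<le> j)"
    proof (cases "i + j < m")
      case True
      then show ?thesis using lt ij by fastforce
    next
      case False
      then have im: "i + j = m" using ij by simp
      then have "1 \<le> i" "1 \<le> j" using slack_tight_diagonal[OF E nc im ij(2) m] by auto
      then obtain i' j' where *: "i = Suc i'" "j = Suc j'" by (metis Suc_le_D One_nat_def)
      show ?thesis
      proof (rule ccontr)
        assume neg: "\<not> ?thesis"
        have "s (Suc i') = s (Suc (Suc i'))"
        proof (cases "i < k")
          case True
          then show ?thesis using k(3)[of "Suc i'"] k(3)[of "Suc (Suc i')"] * by simp
        next
          case False
          then have "j < l" using neg by auto
          then have "Suc i' \<in> {m - l + 1..m}" "Suc (Suc i') \<in> {m - l + 1..m}"
            using im * l(2) by auto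
          then show ?thesis using l(3) by metis
        qed
        then have "slack m s i' j' = 0"
          using slack_diagonal[of i' j' m s] ij im * by simp
        then have "i' + j' = 0 \<or> (k \<le> i' \<and> l \<le> j')" using lt[of i' j'] im * by simp
        then show False using neg * k(1) l(1) kl im by auto
      qed
    qed
    then show "(\<Sum>t = 1..i. block_dir m k l t) = (\<Sum>t = m - j + 1..m. block_dir m k l t)"
      using sum_block_dir_left[of k i l m] sum_block_dir_right[of l j k m] ij by auto
  qed
  then show thesis using blocks[OF k(1) l(1) kl _ False k(3) l(3)] by blast
qed

section \<open>Slices and their vertices\<close>

text \<open>The slack is affine in the sequence; the extra term vanishes for \<open>u + v = 1\<close>.\<close>

lemma slack_linear:
  "slack m (\<lambda>t. u * s t + v * r t) k l + (1 - u - v) * (- real k * (real m - 1 - real l)) =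
    u * slack m s k l + v * slack m r k l"
  by (simp add: slack_def sum.distrib sum_distrib_left[symmetric] algebra_simps)

lemma EG_convex_combination:
  assumes "EG m s" "EG m r" "0 \<le> u" "0 \<le> v" "u + v = 1"
  shows "EG m (\<lambda>t. u * s t + v * r t)"
  unfolding EG_def
proof (intro conjI allI impI)
  show "0 \<le> slack m (\<lambda>t. u * s t + v * r t) k l" if "k + l \<le> m" for k l
    using slack_linear[of m u s v r k l] EG_slack[OF assms(1) that] EG_slack[OF assms(2) that] assms(3-5)
    by (simp add: algebra_simps add_nonneg_nonneg)
  show "u * s (Suc t) + v * r (Suc t) \<le> u * s t + v * r t" if "1 \<le> t \<and> t < m" for t
    using assms that by (intro add_mono mult_left_mono) (auto simp: EG_def)
qed

section \<open>Slices and the faces obtained by freezing coordinates\<close>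

definition score_seq :: "(nat \<Rightarrow> 'n::finite) \<Rightarrow> real \<Rightarrow> real ^ 'n \<Rightarrow> nat \<Rightarrow> real" where
  "score_seq e c x t = x $ e t - c"

text \<open>
  A copy of \<open>F(m)\<close>, shifted by \<open>c\<close>, on the coordinates \<open>e 1, ..., e m\<close>; the other coordinates are
  frozen by \<open>g\<close>. The two faces are again slices, so that the recursion stays inside one space.
\<close>

definition slice :: "(nat \<Rightarrow> 'n::finite) \<Rightarrow> real \<Rightarrow> ('n \<Rightarrow> real) \<Rightarrow> nat \<Rightarrow> (real ^ 'n) set" where
  "slice e c g m = {x. (\<forall>j. j \<notin> e ` {1..m} \<longrightarrow> x $ j = g j) \<and> EG m (score_seq e c x)}"

lemma convex_slice:
  fixes e :: "nat \<Rightarrow> 'n::finite"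
  shows "convex (slice e c g m)"
proof (rule convexI)
  fix x y :: "real ^ 'n" and u v :: real
  assume *: "x \<in> slice e c g m" "y \<in> slice e c g m" "0 \<le> u" "0 \<le> v" "u + v = 1"
  have "score_seq e c (u *\<^sub>R x + v *\<^sub>R y) = (\<lambda>t. u * score_seq e c x t + v * score_seq e c y t)"
  proof
    fix t
    have "c = u * c + v * c" using * by (metis distrib_right mult_1)
    then show "score_seq e c (u *\<^sub>R x + v *\<^sub>R y) t = u * score_seq e c x t + v * score_seq e c y t"
      by (simp add: score_seq_def algebra_simps)
  qed
  moreover have "u * g j + v * g j = g j" for j using * by (metis distrib_right mult_1)
  ultimately show "u *\<^sub>R x + v *\<^sub>R y \<in> slice e c g m"
    using * EG_convex_combination[of m "score_seq e c x" "score_seq e c y" u v]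
    by (simp add: slice_def)
qed

lemma slice_bounds:
  assumes "x \<in> slice e c g m" "t \<in> {1..m}"
  shows "c \<le> x $ e t" "x $ e t \<le> c + real m - 1"
proof -
  have E: "EG m (score_seq e c x)" using assms by (simp add: slice_def)
  show "c \<le> x $ e t" "x $ e t \<le> c + real m - 1"
    using EG_last[OF E] EG_first[OF E] EG_mono[OF E, of t m] EG_mono[OF E, of 1 t] assms(2)
    by (auto simp: score_seq_def)
qed

lemma compact_slice: "compact (slice e c g m)"
proof -
  have "closed (slice e c g m)"
    unfolding slice_def EG_def slack_def score_seq_def
    by (intro closed_Collect_conj closed_Collect_all closed_Collect_imp open_Collect_const
        closed_Collect_le closed_Collect_eq continuous_intros)
  moreover have "bounded (slice e c g m)"
  proof (rule boundedI)
    fix x :: "real ^ 'a" assume x: "x \<in> slice e c g m"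
    have "norm x \<le> (\<Sum>j\<in>UNIV. \<bar>x $ j\<bar>)" by (rule norm_le_l1_cart)
    also have "\<dots> \<le> (\<Sum>j\<in>UNIV. \<bar>g j\<bar> + \<bar>c\<bar> + real m)"
    proof (rule sum_mono)
      fix j
      show "\<bar>x $ j\<bar> \<le> \<bar>g j\<bar> + \<bar>c\<bar> + real m"
      proof (cases "j \<in> e ` {1..m}")
        case True
        then obtain t where "t \<in> {1..m}" "j = e t" by auto
        then show ?thesis using slice_bounds[OF x, of t] by auto
      next
        case False
        then show ?thesis using x by (auto simp: slice_def)
      qed
    qed
    finally show "norm x \<le> (\<Sum>j\<in>UNIV. \<bar>g j\<bar> + \<bar>c\<bar> + real m)" .
  qed
  ultimately show ?thesis by (simp add: compact_eq_bounded_closed)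
qed

definition fix_last :: "(nat \<Rightarrow> 'n) \<Rightarrow> real \<Rightarrow> ('n \<Rightarrow> real) \<Rightarrow> nat \<Rightarrow> nat \<Rightarrow> 'n \<Rightarrow> real" where
  "fix_last e c g m l = override_on g (\<lambda>_. c) (e ` {m - l + 1..m})"

definition fix_first :: "(nat \<Rightarrow> 'n) \<Rightarrow> real \<Rightarrow> ('n \<Rightarrow> real) \<Rightarrow> nat \<Rightarrow> nat \<Rightarrow> 'n \<Rightarrow> real" where
  "fix_first e c g m k = override_on g (\<lambda>_. c + real m - 1) (e ` {1..k})"

lemma eq_override_on_iff:
  assumes "A \<inter> B = {}"
  shows "(\<forall>j. j \<notin> B \<longrightarrow> f j = override_on g (\<lambda>_. r) A j) \<longleftrightarrow>
    (\<forall>j. j \<notin> A \<union> B \<longrightarrow> f j = g j) \<and> (\<forall>j\<in>A. f j = r)"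
  using assms by (auto simp: override_on_def)

lemma slice_fix_last:
  fixes e :: "nat \<Rightarrow> 'n::finite"
  assumes e: "inj_on e {1..m}" and l: "l \<le> m"
  shows "slice e c (fix_last e c g m l) (m - l) = slice e c g m \<inter> {x. \<forall>t\<in>{m - l + 1..m}. x $ e t = c}"
proof -
  have U: "e ` {1..m} = e ` {1..m - l} \<union> e ` {m - l + 1..m}"
    unfolding image_Un[symmetric] using l by (intro arg_cong[of _ _ "image e"]) auto
  have D: "e ` {1..m - l} \<inter> e ` {m - l + 1..m} = {}"
    using l by (subst inj_on_image_Int[OF e, symmetric]) auto
  have E: "EG m (score_seq e c x) \<longleftrightarrow> EG (m - l) (score_seq e c x)"
    if "\<forall>t\<in>{m - l + 1..m}. x $ e t = c" for x
    using that by (intro EG_peel_lasts l) (auto simp: score_seq_def)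
  have "(\<forall>j. j \<notin> e ` {1..m - l} \<longrightarrow> x $ j = fix_last e c g m l j) \<longleftrightarrow>
      (\<forall>j. j \<notin> e ` {1..m} \<longrightarrow> x $ j = g j) \<and> (\<forall>j\<in>e ` {m - l + 1..m}. x $ j = c)" for x :: "real ^ 'n"
    unfolding U fix_last_def Un_commute[of "e ` {1..m - l}"] by (rule eq_override_on_iff) (use D in blast)
  then show ?thesis
    using E unfolding slice_def by (auto simp del: One_nat_def)
qed

text \<open>Every peeled entry of full degree lowers the others by one, hence the offset
  \<open>c + real k\<close>. Shortening by \<open>k\<close> at the same time keeps the upper bound
  at \<open>c + real m - 1\<close>.\<close>

lemma slice_fix_first:
  fixes e :: "nat \<Rightarrow> 'n::finite"
  assumes e: "inj_on e {1..m}" and k: "k \<le> m"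
  shows "slice (\<lambda>t. e (t + k)) (c + real k) (fix_first e c g m k) (m - k) =
    slice e c g m \<inter> {x. \<forall>t\<in>{1..k}. x $ e t = c + real m - 1}"
proof -
  have I: "(\<lambda>t. e (t + k)) ` {1..m - k} = e ` {k + 1..m}"
  proof -
    have "(\<lambda>t. t + k) ` {1..m - k} = {k + 1..m}"
      using k by (subst image_add_atLeastAtMost') auto
    then show ?thesis by (metis image_image)
  qed
  have U: "e ` {1..m} = e ` {1..k} \<union> e ` {k + 1..m}"
    unfolding image_Un[symmetric] using k by (intro arg_cong[of _ _ "image e"]) auto
  have D: "e ` {1..k} \<inter> e ` {k + 1..m} = {}"
    using k by (subst inj_on_image_Int[OF e, symmetric]) auto
  have E: "EG m (score_seq e c x) \<longleftrightarrow> EG (m - k) (score_seq (\<lambda>t. e (t + k)) (c + real k) x)"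
    if "\<forall>t\<in>{1..k}. x $ e t = c + real m - 1" for x
  proof -
    have "score_seq (\<lambda>t. e (t + k)) (c + real k) x = (\<lambda>t. score_seq e c x (t + k) - real k)"
      by (auto simp: score_seq_def)
    then show ?thesis
      using EG_peel_firsts[OF k, of "score_seq e c x"] that by (simp add: score_seq_def)
  qed
  have "(\<forall>j. j \<notin> e ` {k + 1..m} \<longrightarrow> x $ j = fix_first e c g m k j) \<longleftrightarrow>
      (\<forall>j. j \<notin> e ` {1..m} \<longrightarrow> x $ j = g j) \<and> (\<forall>j\<in>e ` {1..k}. x $ j = c + real m - 1)" for x :: "real ^ 'n"
    unfolding U fix_first_def by (rule eq_override_on_iff) (use D in blast)
  then show ?thesis
    using E unfolding slice_def I by (auto simp del: One_nat_def)
qed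

lemma inj_on_shift:
  fixes e :: "nat \<Rightarrow> 'n"
  assumes "inj_on e {1..m}"
  shows "inj_on (\<lambda>t. e (t + k)) {1..m - k}"
proof (rule inj_onI)
  fix x y assume "x \<in> {1..m - k}" "y \<in> {1..m - k}" "e (x + k) = e (y + k)"
  moreover have "t + k \<in> {1..m}" if "t \<in> {1..m - k}" for t
    using that unfolding atLeastAtMost_iff by linarith
  ultimately show "x = y" using inj_onD[OF assms, of "x + k" "y + k"] by auto
qed

definition lift_dir :: "(nat \<Rightarrow> 'n::finite) \<Rightarrow> nat \<Rightarrow> (nat \<Rightarrow> real) \<Rightarrow> real ^ 'n" where
  "lift_dir e m d = (\<chi> j. if j \<in> e ` {1..m} then d (inv_into {1..m} e j) else 0)"

lemma lift_dir_in:
  assumes "inj_on e {1..m}" "t \<in> {1..m}"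
  shows "lift_dir e m d $ e t = d t"
  using assms by (simp add: lift_dir_def inv_into_f_f)

lemma lift_dir_out: "j \<notin> e ` {1..m} \<Longrightarrow> lift_dir e m d $ j = 0"
  by (auto simp: lift_dir_def)

lemma slice_add_lift_dir:
  assumes "inj_on e {1..m}" "x \<in> slice e c g m"
    and "EG m (\<lambda>t. score_seq e c x t + u * d t)"
  shows "x + u *\<^sub>R lift_dir e m d \<in> slice e c g m"
proof -
  have "EG m (score_seq e c (x + u *\<^sub>R lift_dir e m d)) \<longleftrightarrow> EG m (\<lambda>t. score_seq e c x t + u * d t)"
    by (rule EG_cong) (simp add: score_seq_def lift_dir_in[OF assms(1)])
  then show ?thesis
    using assms(2,3) by (simp add: slice_def lift_dir_out)
qed

lemma last_face:
  assumes "1 \<le> m"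
  shows "slice e c g m \<inter> {x. x $ e m = c} face_of slice e c g m"
proof -
  have "slice e c g m \<inter> {x. axis (e m) 1 \<bullet> x = c} face_of slice e c g m"
    using slice_bounds(1)[of _ e c g m m] assms
    by (intro face_of_Int_supporting_hyperplane_ge convex_slice) (auto simp: inner_axis')
  then show ?thesis by (simp add: inner_axis')
qed

lemma first_face:
  assumes "1 \<le> m"
  shows "slice e c g m \<inter> {x. x $ e 1 = c + real m - 1} face_of slice e c g m"
proof -
  have "slice e c g m \<inter> {x. axis (e 1) 1 \<bullet> x = c + real m - 1} face_of slice e c g m"
    using slice_bounds(2)[of _ e c g m 1] assms
    by (intro face_of_Int_supporting_hyperplane_le convex_slice) (auto simp: inner_axis')
  then show ?thesis by (simp add: inner_axis')
qed

text \<open>The inequality with \<open>k = l = 1\<close> limits the difference of first and last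
  entry to \<open>m - 2\<close>.\<close>

lemma first_last_faces_disjoint:
  assumes "2 \<le> m" "x \<in> slice e c g m" "x $ e m = c" shows "x $ e 1 \<noteq> c + real m - 1"
  using EG_first_last[of m "score_seq e c x"] assms by (auto simp: slice_def score_seq_def)

lemma midpoint_of_opposite_steps:
  fixes D :: "'a::real_vector"
  assumes "\<epsilon> > 0" "D \<noteq> 0"
  shows "x \<in> open_segment (x + \<epsilon> *\<^sub>R D) (x + (-\<epsilon>) *\<^sub>R D)"
proof -
  have "x = (1 - 1/2) *\<^sub>R (x + \<epsilon> *\<^sub>R D) + (1/2) *\<^sub>R (x + (-\<epsilon>) *\<^sub>R D)"
    by (simp add: algebra_simps flip: scaleR_add_left)
  moreover have "x + \<epsilon> *\<^sub>R D \<noteq> x + (-\<epsilon>) *\<^sub>R D"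
  proof
    assume "x + \<epsilon> *\<^sub>R D = x + (-\<epsilon>) *\<^sub>R D"
    then have "(2 * \<epsilon>) *\<^sub>R D = 0"
      by (metis add.inverse_inverse add_diff_cancel_left' diff_minus_eq_add diff_self mult_2 scaleR_add_left scaleR_minus_left)
    then show False using assms by simp
  qed
  ultimately show ?thesis unfolding in_segment by (intro conjI exI[of _ "1/2"]) auto
qed

section \<open>Vertices of slices\<close>

text \<open>A point on neither face is the midpoint of the two-sided move given by
  \<open>EG_move\<close>, hence not extreme.\<close>

lemma extreme_point_of_slice_cases:
  assumes e: "inj_on e {1..m}" and m: "1 \<le> m" and x: "x extreme_point_of slice e c g m"
  shows "x $ e m = c \<or> x $ e 1 = c + real m - 1"
proof (rule ccontr)
  assume *: "\<not> ?thesis"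
  have xs: "x \<in> slice e c g m" using x by (simp add: extreme_point_of_def)
  then have E: "EG m (score_seq e c x)" by (simp add: slice_def)
  have nc: "0 < score_seq e c x m" "score_seq e c x 1 < real m - 1"
    using EG_first[OF E m] EG_last[OF E m] * by (auto simp: score_seq_def)
  \<comment> \<open>The first entry, \<open>l\<close> for blocks and \<open>1\<close> for the
    constant direction, certifies that the lifted direction is not the zero vector.\<close>
  have no: False if "\<epsilon> > 0" "d 1 \<noteq> 0" "EG m (\<lambda>t. score_seq e c x t + \<epsilon> * d t)"
     "EG m (\<lambda>t. score_seq e c x t + (-\<epsilon>) * d t)" for \<epsilon> d
  proof -
    have "lift_dir e m d $ e 1 \<noteq> 0" using that m by (subst lift_dir_in[OF e]) auto
    then have "lift_dir e m d \<noteq> 0" by auto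
    then have "x \<in> open_segment (x + \<epsilon> *\<^sub>R lift_dir e m d) (x + (-\<epsilon>) *\<^sub>R lift_dir e m d)"
      using that by (intro midpoint_of_opposite_steps)
    then show False
      using x slice_add_lift_dir[OF e xs that(3)] slice_add_lift_dir[OF e xs that(4)]
      unfolding extreme_point_of_def by blast
  qed
  show False
  proof (rule EG_move[OF E m nc], goal_cases)
    case (1 k l \<epsilon>)
    have "block_dir m k l 1 \<noteq> 0" using 1(1,2) by (simp add: block_dir_def)
    from no[OF 1(4) this 1(8,9)] show ?case .
  next
    case (2 \<epsilon>)
    from no[OF 2(1) _ 2(3,4)] show ?case by simp
  qed
qed

lemma slice_0: "slice e c g 0 = {\<chi> j. g j}"
  by (auto simp: slice_def EG_def vec_eq_iff)

text \<open>For \<open>m = 1\<close> the lower and the upper bound on the single free coordinate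
  coincide.\<close>

lemma slice_1:
  assumes "inj_on e {1..1::nat}"
  shows "slice e c g 1 = {\<chi> j. fix_last e c g 1 1 j}"
proof -
  have "slice e c g 1 = slice e c g 1 \<inter> {x. \<forall>t\<in>{1 - 1 + 1..1}. x $ e t = c}"
    using slice_bounds[of _ e c g 1 1] by fastforce
  also have "\<dots> = slice e c (fix_last e c g 1 1) (1 - 1)"
    using slice_fix_last[OF assms, of 1] by simp
  finally show ?thesis by (simp add: slice_0)
qed

abbreviation (input) extreme_points :: "'a::real_vector set \<Rightarrow> 'a set" where
  "extreme_points S \<equiv> {v. v extreme_point_of S}"

lemma extreme_points_slice_Suc:
  assumes e: "inj_on e {1..Suc m}"
  shows "extreme_points (slice e c g (Suc m)) =
    extreme_points (slice e c (fix_last e c g (Suc m) 1) m) \<union>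
    extreme_points (slice (\<lambda>t. e (t + 1)) (c + 1) (fix_first e c g (Suc m) 1) m)"
proof -
  have A: "slice e c (fix_last e c g (Suc m) 1) m = slice e c g (Suc m) \<inter> {x. x $ e (Suc m) = c}"
    using slice_fix_last[OF e, of 1] by simp
  have B: "slice (\<lambda>t. e (t + 1)) (c + 1) (fix_first e c g (Suc m) 1) m =
     slice e c g (Suc m) \<inter> {x. x $ e 1 = c + real (Suc m) - 1}"
    using slice_fix_first[OF e, of 1] by simp
  show ?thesis
    unfolding A B extreme_point_of_face[OF last_face[of "Suc m", simplified]]
    using extreme_point_of_slice_cases[OF e, of _ c g]
      extreme_point_of_face[OF last_face[of "Suc m" e c g]]
      extreme_point_of_face[OF first_face[of "Suc m" e c g]]
    by (auto simp: extreme_point_of_def)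
qed

text \<open>Two disjoint faces double the count, starting at \<open>m = 2\<close>. For
  \<open>m = 0\<close> and \<open>m = 1\<close> the slice is one point, and truncated subtraction
  gives exponent \<open>0\<close> in both cases.\<close>

lemma finite_card_extreme_points_slice:
  assumes "inj_on e {1..m}"
  shows "finite (extreme_points (slice e c g m)) \<and> card (extreme_points (slice e c g m)) = 2 ^ (m - 1)"
  using assms
proof (induction m arbitrary: e c g)
  case 0
  then show ?case by (simp add: slice_0)
next
  case (Suc m)
  show ?case
  proof (cases "m = 0")
    case True
    then show ?thesis using slice_1[of e c g] Suc.prems by simp
  next
    case False
    let ?A = "slice e c (fix_last e c g (Suc m) 1) m"
    let ?B = "slice (\<lambda>t. e (t + 1)) (c + 1) (fix_first e c g (Suc m) 1) m"
    have "inj_on e {1..m}" "inj_on (\<lambda>t. e (t + 1)) {1..m}"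
      using Suc.prems inj_on_shift[OF Suc.prems, of 1] by (auto intro: inj_on_subset)
    note IH = Suc.IH[OF this(1), of c "fix_last e c g (Suc m) 1"]
      Suc.IH[OF this(2), of "c + 1" "fix_first e c g (Suc m) 1"]
    have "?A \<inter> ?B = {}"
      using slice_fix_last[OF Suc.prems, of 1 c g] slice_fix_first[OF Suc.prems, of 1 c g]
        first_last_faces_disjoint[of "Suc m" _ e c g] False by auto
    then have "extreme_points ?A \<inter> extreme_points ?B = {}"
      by (auto simp: extreme_point_of_def)
    moreover have "2 ^ m = 2 ^ (m - 1) + (2::nat) ^ (m - 1)"
      using False by (cases m) auto
    ultimately show ?thesis
      unfolding extreme_points_slice_Suc[OF Suc.prems] using IH by (simp add: card_Un_disjoint)
  qed
qed

section \<open>Edges between the two faces\<close>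

lemma edge_of_imp_segment:
  fixes S :: "'a::euclidean_space set"
  assumes "convex S" "compact S" "E edge_of S"
  obtains v u where "v \<noteq> u" "v extreme_point_of S" "u extreme_point_of S" "E = closed_segment v u"
proof -
  have E: "E face_of S" "aff_dim E = 1" using assms by (auto simp: edge_of_def)
  then have "compact E" "convex E" "collinear E" "E \<noteq> {}"
    using assms face_of_imp_compact face_of_imp_convex by (auto simp: collinear_aff_dim)
  then obtain v u where vu: "E = closed_segment v u"
    using compact_convex_collinear_segment by blast
  then have "v \<noteq> u" using E by auto
  moreover have "v extreme_point_of S" "u extreme_point_of S"
    using extreme_point_of_face[OF E(1)] unfolding vu by (auto simp: extreme_point_of_segment)
  ultimately show ?thesis using that vu by blast
qed

lemma segment_edge_ofI:
  fixes S :: "'a::euclidean_space set"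
  assumes "v \<noteq> u" "closed_segment v u face_of S"
  shows "closed_segment v u edge_of S"
  using assms by (simp add: edge_of_def segment_convex_hull aff_dim_convex_hull aff_dim_2)

lemma edge_of_face: "F face_of S \<Longrightarrow> E edge_of F \<longleftrightarrow> E edge_of S \<and> E \<subseteq> F"
  by (auto simp: edge_of_def face_of_face)

lemma extreme_point_of_subset:
  "x extreme_point_of S \<Longrightarrow> T \<subseteq> S \<Longrightarrow> x \<in> T \<Longrightarrow> x extreme_point_of T"
  by (auto simp: extreme_point_of_def)

text \<open>The slack at \<open>(k + i, l + j)\<close> splits into that of the outer blocks and that
  of the middle part. If \<open>(k, l)\<close> is tight, the middle part thus inherits all
  inequalities.\<close>

lemma slack_inner:
  assumes "k + l \<le> m" "i + j \<le> m - l - k"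
  shows "slack (m - l - k) (\<lambda>t. s (t + k) - real k) i j = slack m s (k + i) (l + j) - slack m s k l"
  using assms(2)
proof (induction i)
  case 0
  then show ?case
  proof (induction j)
    case (Suc j)
    then have "l + j < m" "j < m - l - k" "m - l - k - j + k = m - (l + j)"
      using assms(1) by auto
    then show ?case using Suc by (simp add: slack_Suc_right)
  qed simp
next
  case (Suc i)
  have "real (m - l - k) = real m - real l - real k" using assms(1) by auto
  then show ?case using Suc by (simp add: slack_Suc_left add.commute)
qed

lemma EG_inner:
  assumes "EG m s" "k + l \<le> m" "slack m s k l = 0"
  shows "EG (m - l - k) (\<lambda>t. s (t + k) - real k)"
  unfolding EG_def
proof (intro conjI allI impI)
  show "0 \<le> slack (m - l - k) (\<lambda>t. s (t + k) - real k) i j" if "i + j \<le> m - l - k" for i j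
    using slack_inner[OF assms(2) that, of s] EG_slack[OF assms(1), of "k + i" "l + j"] that assms
    by simp
  show "s (Suc t + k) - real k \<le> s (t + k) - real k" if "1 \<le> t \<and> t < m - l - k" for t
  proof -
    have "Suc t + k \<le> m" using that assms(2) by linarith
    then show ?thesis using EG_mono[OF assms(1), of "t + k" "Suc t + k"] that by simp
  qed
qed

text \<open>Once the \<open>l\<close> trailing zeros are peeled, \<open>real m - 1 - real l\<close>
  is the greatest possible value, so the first block peels off as well.\<close>

lemma EG_blocks:
  assumes "k + l \<le> m" "1 \<le> l"
    and K: "\<And>t. t \<in> {1..k} \<Longrightarrow> s t = real m - 1 - real l"
    and L: "\<And>t. t \<in> {m - l + 1..m} \<Longrightarrow> s t = 0"
  shows "EG m s \<longleftrightarrow> EG (m - l - k) (\<lambda>t. s (t + k) - real k)"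
proof -
  have "EG m s \<longleftrightarrow> EG (m - l) s"
    using assms by (intro EG_peel_lasts) auto
  also have "\<dots> \<longleftrightarrow> EG (m - l - k) (\<lambda>t. s (t + k) - real k)"
    using assms by (intro EG_peel_firsts) auto
  finally show ?thesis .
qed

text \<open>After the addition the first block has value \<open>m - 1\<close>; peeling it first
  turns the value \<open>k\<close> of the last block into \<open>0\<close>. The middle part that
  remains is the one left by \<open>EG_blocks\<close>.\<close>

lemma EG_add_block_dir:
  assumes E: "EG m s" and kl: "k + l \<le> m" "1 \<le> l"
    and K: "\<And>t. t \<in> {1..k} \<Longrightarrow> s t = real m - 1 - real l"
    and L: "\<And>t. t \<in> {m - l + 1..m} \<Longrightarrow> s t = 0"
  shows "EG m (\<lambda>t. s t + block_dir m k l t)"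
proof -
  define r where "r = (\<lambda>t. s t + block_dir m k l t)"
  have rK: "r t = real m - 1" if "t \<in> {1..k}" for t
    using K[OF that] that by (simp add: r_def block_dir_def)
  have rL: "r t = real k" if "t \<in> {m - l + 1..m}" for t
    using L[OF that] that kl by (auto simp: r_def block_dir_def)
  have "EG m r \<longleftrightarrow> EG (m - k) (\<lambda>t. r (t + k) - real k)"
    using rK kl by (intro EG_peel_firsts) auto
  also have "\<dots> \<longleftrightarrow> EG (m - k - l) (\<lambda>t. r (t + k) - real k)"
  proof (rule EG_peel_lasts)
    fix t assume "t \<in> {m - k - l + 1..m - k}"
    then have "t + k \<in> {m - l + 1..m}" using kl unfolding atLeastAtMost_iff by linarith
    then show "r (t + k) - real k = 0" using rL by simp
  qed (use kl in auto)
  also have "\<dots> \<longleftrightarrow> EG (m - k - l) (\<lambda>t. s (t + k) - real k)"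
    by (rule EG_cong) (auto simp: r_def block_dir_def)
  also have "\<dots> \<longleftrightarrow> EG m s"
    using EG_blocks[OF kl K L] by (simp add: add.commute)
  finally show ?thesis using E by (simp add: r_def)
qed

lemma slack_blocks:
  assumes "k + l \<le> m"
    and "\<And>t. t \<in> {1..k} \<Longrightarrow> s t = a" "\<And>t. t \<in> {m - l + 1..m} \<Longrightarrow> s t = b"
  shows "slack m s k l = real k * (real m - 1 - real l) - real k * a + real l * b"
proof -
  have "(\<Sum>t = 1..k. s t) = (\<Sum>t = 1..k. a)"
    by (rule sum.cong) (use assms(2) in auto)
  moreover have "(\<Sum>t = m - l + 1..m. s t) = (\<Sum>t = m - l + 1..m. b)"
    by (rule sum.cong) (use assms(3) in auto)
  moreover have "card {m - l + 1..m} = l" using assms(1) by simp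
  ultimately show ?thesis by (simp add: slack_def)
qed

text \<open>The drops of \<open>a\<close> and \<open>b\<close> from \<open>i\<close> to
  \<open>j\<close> are nonnegative and a combination of them with positive weights vanishes;
  monotonicity does the rest.\<close>

lemma EG_const_on_segment:
  assumes "EG m a" "EG m b" "0 < u" "u < 1"
    and x: "\<And>t. t \<in> {i..j} \<Longrightarrow> x t = (1 - u) * a t + u * b t" "x i = x j"
    and ij: "1 \<le> i" "j \<le> m" "t \<in> {i..j}"
  shows "a t = a i" "b t = b i"
proof -
  have "i \<le> j" using ij by auto
  then have le: "0 \<le> a i - a j" "0 \<le> b i - b j"
    using EG_mono[OF assms(1), of i j] EG_mono[OF assms(2), of i j] ij by auto
  have "(1 - u) * (a i - a j) + u * (b i - b j) = 0"
    using x(1)[of i] x(1)[of j] x(2) \<open>i \<le> j\<close> by (simp add: algebra_simps)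
  then have "(1 - u) * (a i - a j) = 0" "u * (b i - b j) = 0"
    using le assms(3,4) by (simp_all add: add_nonneg_eq_0_iff)
  then have "a i = a j" "b i = b j" using assms(3,4) by auto
  then show "a t = a i" "b t = b i"
    using EG_mono[OF assms(1), of i t] EG_mono[OF assms(1), of t j]
      EG_mono[OF assms(2), of i t] EG_mono[OF assms(2), of t j] ij by auto
qed

section \<open>Block edges and the constant edge\<close>

locale labelled_slice =
  fixes e :: "nat \<Rightarrow> 'n::finite" and c :: real and g :: "'n \<Rightarrow> real" and m :: nat
  assumes inj: "inj_on e {1..m}" and m: "2 \<le> m"
begin

abbreviation S where "S \<equiv> slice e c g m"

abbreviation \<delta> where "\<delta> k l \<equiv> lift_dir e m (block_dir m k l)"

text \<open>The possible starting points of an edge in direction \<open>\<delta> k l\<close>. The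
  value on the first block is the greatest one possible when the last block is at \<open>c\<close>,
  so this is a copy of \<open>F(m - k - l)\<close>.\<close>

definition V where
  "V k l = S \<inter> {x. (\<forall>t\<in>{m - l + 1..m}. x $ e t = c) \<and> (\<forall>t\<in>{1..k}. x $ e t = c + real m - 1 - real l)}"

lemma V_eq_slice:
  assumes "k + l \<le> m"
  shows "V k l = slice (\<lambda>t. e (t + k)) (c + real k)
    (fix_first e c (fix_last e c g m l) (m - l) k) (m - l - k)"
proof -
  have "inj_on e {1..m - l}" using inj by (rule inj_on_subset) auto
  then have "slice (\<lambda>t. e (t + k)) (c + real k)
      (fix_first e c (fix_last e c g m l) (m - l) k) (m - l - k) =
    S \<inter> {x. \<forall>t\<in>{m - l + 1..m}. x $ e t = c} \<inter> {x. \<forall>t\<in>{1..k}. x $ e t = c + real (m - l) - 1}"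
    using slice_fix_first[of e "m - l" k c "fix_last e c g m l"] slice_fix_last[OF inj, of l c g] assms
    by auto
  then show ?thesis using assms by (auto simp: V_def)
qed

lemma finite_card_extreme_points_V:
  assumes "k + l \<le> m"
  shows "finite (extreme_points (V k l)) \<and> card (extreme_points (V k l)) = 2 ^ (m - l - k - 1)"
proof -
  have "inj_on e {1..m - l}" using inj by (rule inj_on_subset) auto
  then show ?thesis
    unfolding V_eq_slice[OF assms]
    using finite_card_extreme_points_slice inj_on_shift by blast
qed

lemma \<delta>_nth: "t \<in> {1..m} \<Longrightarrow> \<delta> k l $ e t = block_dir m k l t"
  using lift_dir_in[OF inj] by blast

lemma vec_eqI:
  assumes "\<And>t. t \<in> {1..m} \<Longrightarrow> x $ e t = y $ e t" "\<And>j. j \<notin> e ` {1..m} \<Longrightarrow> x $ j = y $ j"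
  shows "x = y"
  using assms by (metis vec_eq_iff image_iff)

lemma EG_seq: "x \<in> S \<Longrightarrow> EG m (score_seq e c x)"
  by (simp add: slice_def)

lemma V_add_\<delta>:
  assumes kl: "1 \<le> k" "1 \<le> l" "k + l \<le> m" and v: "v \<in> V k l"
  shows "v + \<delta> k l \<in> S"
proof -
  have "EG m (\<lambda>t. score_seq e c v t + 1 * block_dir m k l t)"
    using EG_add_block_dir[OF EG_seq kl(3,2), of v] v by (simp add: V_def score_seq_def)
  then show ?thesis
    using slice_add_lift_dir[OF inj, of v c g 1] v by (simp add: V_def)
qed

text \<open>The points that are constant on both blocks and tight for \<open>(k, l)\<close> lie in a
  prism over \<open>V k l\<close> with sides parallel to \<open>\<delta> k l\<close>.\<close>

lemma project_to_V:
  assumes kl: "1 \<le> k" "1 \<le> l" "k + l \<le> m" and x: "x \<in> S"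
    and K: "\<And>t. t \<in> {1..k} \<Longrightarrow> x $ e t = x $ e 1"
    and L: "\<And>t. t \<in> {m - l + 1..m} \<Longrightarrow> x $ e t = x $ e m"
    and tight: "slack m (score_seq e c x) k l = 0"
  obtains \<theta> where "0 \<le> \<theta>" "\<theta> \<le> 1" "x - \<theta> *\<^sub>R \<delta> k l \<in> V k l"
proof -
  let ?s = "score_seq e c x"
  \<comment> \<open>This height moves the last block down to \<open>c\<close>. Tightness then forces
    the right value on the first block, and the bounds \<open>0\<close> and \<open>m - 1\<close>
    give \<open>0 \<le> \<theta> \<le> 1\<close>.\<close>
  define \<theta> where "\<theta> = ?s m / real k"
  have E: "EG m ?s" using x by (rule EG_seq)
  have sK: "?s t = ?s 1" if "t \<in> {1..k}" for t using K[OF that] by (simp add: score_seq_def)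
  have sL: "?s t = ?s m" if "t \<in> {m - l + 1..m}" for t using L[OF that] by (simp add: score_seq_def)
  have bm: "?s m = \<theta> * real k" using kl by (simp add: \<theta>_def)
  have "real k * (real m - 1 - real l - ?s 1 + \<theta> * real l) = 0"
    using slack_blocks[of k l m ?s, OF kl(3) sK sL] tight bm by (simp add: algebra_simps)
  then have b1: "?s 1 = real m - 1 - real l + \<theta> * real l" using kl by simp
  have "\<theta> * real l \<le> 1 * real l"
    using EG_first[OF E] m b1 by simp
  then have \<theta>: "0 \<le> \<theta>" "\<theta> \<le> 1"
    using EG_last[OF E] m kl mult_right_le_imp_le[of \<theta> "real l" 1] by (auto simp: \<theta>_def)
  let ?y = "x - \<theta> *\<^sub>R \<delta> k l"
  have sy: "score_seq e c ?y t = ?s t - \<theta> * block_dir m k l t" if "t \<in> {1..m}" for t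
    using \<delta>_nth[OF that] by (simp add: score_seq_def)
  have yK: "score_seq e c ?y t = real m - 1 - real l" if "t \<in> {1..k}" for t
    using sy[of t] sK[OF that] b1 that kl by (simp add: block_dir_def)
  have yL: "score_seq e c ?y t = 0" if "t \<in> {m - l + 1..m}" for t
    using sy[of t] sL[OF that] bm that kl by (auto simp: block_dir_def)
  have "EG (m - l - k) (\<lambda>t. score_seq e c ?y (t + k) - real k) \<longleftrightarrow>
      EG (m - l - k) (\<lambda>t. ?s (t + k) - real k)"
    using sy by (intro EG_cong) (auto simp: block_dir_def)
  then have "EG m (score_seq e c ?y)"
    using EG_blocks[of k l m "score_seq e c ?y", OF kl(3,2) yK yL] EG_inner[OF E kl(3) tight] by blast
  then have "?y \<in> S" using x by (simp add: slice_def lift_dir_out)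
  then have "?y \<in> V k l"
    using yK yL unfolding V_def score_seq_def by (simp add: diff_eq_eq algebra_simps)
  then show ?thesis using that \<theta> by blast
qed

text \<open>Constancy on the blocks and tightness of \<open>(k, l)\<close> pass from a point of the
  segment to the ends \<open>a\<close>, \<open>b\<close> of any open segment through it. In the
  prism of \<open>project_to_V\<close> their base points average to the extreme point
  \<open>v\<close>, so both equal \<open>v\<close>.\<close>

lemma block_edge:
  assumes kl: "1 \<le> k" "1 \<le> l" "k + l \<le> m" and v: "v extreme_point_of V k l"
  shows "closed_segment v (v + \<delta> k l) edge_of S"
proof (rule segment_edge_ofI)
  have vV: "v \<in> V k l" using v by (simp add: extreme_point_of_def)
  have \<delta>m: "\<delta> k l $ e m = real k" using \<delta>_nth[of m k l] kl by (simp add: block_dir_def)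
  then have "\<delta> k l $ e m \<noteq> 0" using kl by simp
  then show "v \<noteq> v + \<delta> k l" by (metis add_cancel_right_right zero_index)
  show "closed_segment v (v + \<delta> k l) face_of S"
    unfolding face_of_def
  proof (intro conjI ballI impI convex_closed_segment)
    have "v \<in> S" using vV by (simp add: V_def)
    then show "closed_segment v (v + \<delta> k l) \<subseteq> S"
      using V_add_\<delta>[OF kl vV] by (intro closed_segment_subset convex_slice)
  next
    fix a b x
    assume aS: "a \<in> S" and bS: "b \<in> S" and "x \<in> closed_segment v (v + \<delta> k l)" and "x \<in> open_segment a b"
    then obtain \<theta> u where "x = (1 - \<theta>) *\<^sub>R v + \<theta> *\<^sub>R (v + \<delta> k l)"
      and xu: "x = (1 - u) *\<^sub>R a + u *\<^sub>R b" and u: "0 < u" "u < 1"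
      unfolding in_segment by blast
    then have "x = v + \<theta> *\<^sub>R \<delta> k l" by (simp add: algebra_simps)
    note x = this xu
    have ab: "score_seq e c x t = (1 - u) * score_seq e c a t + u * score_seq e c b t" for t
      unfolding x(2) by (simp add: score_seq_def algebra_simps)
    note Ea = EG_seq[OF aS] and Eb = EG_seq[OF bS]
    have xK: "score_seq e c x t = real m - 1 - real l + \<theta> * real l" if "t \<in> {1..k}" for t
      using \<delta>_nth[of t k l] vV that kl unfolding x(1) by (simp add: score_seq_def V_def block_dir_def)
    have xL: "score_seq e c x t = \<theta> * real k" if "t \<in> {m - l + 1..m}" for t
      using \<delta>_nth[of t k l] vV that kl unfolding x(1) by (auto simp: score_seq_def V_def block_dir_def)
    have K: "score_seq e c a t = score_seq e c a 1" "score_seq e c b t = score_seq e c b 1"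
      if "t \<in> {1..k}" for t
      by (rule EG_const_on_segment[OF Ea Eb u ab, of 1 k]; use that xK[of 1] xK[of k] kl in auto)+
    have L: "score_seq e c a t = score_seq e c a (m - l + 1)"
      "score_seq e c b t = score_seq e c b (m - l + 1)" if "t \<in> {m - l + 1..m}" for t
      by (rule EG_const_on_segment[OF Ea Eb u ab, of "m - l + 1" m];
          use that xL[of "m - l + 1"] xL[of m] kl in auto)+
    have "slack m (score_seq e c x) k l = 0"
      using slack_blocks[OF kl(3) xK xL] by (simp add: algebra_simps)
    moreover have "score_seq e c x = (\<lambda>t. (1 - u) * score_seq e c a t + u * score_seq e c b t)"
      by (rule ext) (rule ab)
    then have "slack m (score_seq e c x) k l =
        (1 - u) * slack m (score_seq e c a) k l + u * slack m (score_seq e c b) k l"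
      using slack_linear[of m "1 - u" "score_seq e c a" u "score_seq e c b" k l]
      by simp
    ultimately have "slack m (score_seq e c a) k l = 0" "slack m (score_seq e c b) k l = 0"
      using EG_slack[OF Ea kl(3)] EG_slack[OF Eb kl(3)] u by (simp_all add: add_nonneg_eq_0_iff)
    moreover have "m \<in> {m - l + 1..m}" using kl m by auto
    moreover have "a $ e t = a $ e 1" "b $ e t = b $ e 1" if "t \<in> {1..k}" for t
      using K[OF that] by (simp_all add: score_seq_def)
    moreover have "a $ e t = a $ e m" "b $ e t = b $ e m" if "t \<in> {m - l + 1..m}" for t
      using L[OF that] L[OF \<open>m \<in> {m - l + 1..m}\<close>] by (simp_all add: score_seq_def)
    ultimately obtain \<alpha> \<beta> where \<alpha>: "0 \<le> \<alpha>" "\<alpha> \<le> 1" "a - \<alpha> *\<^sub>R \<delta> k l \<in> V k l"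
      and \<beta>: "0 \<le> \<beta>" "\<beta> \<le> 1" "b - \<beta> *\<^sub>R \<delta> k l \<in> V k l"
      using project_to_V[OF kl aS] project_to_V[OF kl bS] by metis
    let ?a = "a - \<alpha> *\<^sub>R \<delta> k l" and ?b = "b - \<beta> *\<^sub>R \<delta> k l"
    have Vm: "y $ e m = c" if "y \<in> V k l" for y
      using that \<open>m \<in> {m - l + 1..m}\<close> unfolding V_def by blast
    have eq: "v + \<theta> *\<^sub>R \<delta> k l = ((1 - u) *\<^sub>R ?a + u *\<^sub>R ?b) + ((1 - u) * \<alpha> + u * \<beta>) *\<^sub>R \<delta> k l"
      using x by (simp add: algebra_simps)
    \<comment> \<open>The coordinate \<open>e m\<close> separates height from base: it is
      \<open>c\<close> on all of \<open>V k l\<close> and \<open>k\<close> in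
      \<open>\<delta> k l\<close>.\<close>
    have "(v + \<theta> *\<^sub>R \<delta> k l) $ e m = c + \<theta> * real k"
      using Vm[OF vV] \<delta>m by simp
    moreover have "(((1 - u) *\<^sub>R ?a + u *\<^sub>R ?b) + ((1 - u) * \<alpha> + u * \<beta>) *\<^sub>R \<delta> k l) $ e m =
        c + ((1 - u) * \<alpha> + u * \<beta>) * real k"
      using Vm[OF \<alpha>(3)] Vm[OF \<beta>(3)] \<delta>m by (simp add: algebra_simps)
    ultimately have "\<theta> = (1 - u) * \<alpha> + u * \<beta>" using kl unfolding eq by simp
    then have v_eq: "v = (1 - u) *\<^sub>R ?a + u *\<^sub>R ?b" using eq by simp
    moreover have "v \<notin> open_segment ?a ?b"
      using v \<alpha>(3) \<beta>(3) by (simp add: extreme_point_of_def)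
    ultimately have ab: "?a = ?b" using u unfolding in_segment by blast
    have "v = ?a"
      using v_eq unfolding ab[symmetric] by (metis diff_add_cancel scaleR_add_left scaleR_one)
    then have "a = v + \<alpha> *\<^sub>R \<delta> k l" "b = v + \<beta> *\<^sub>R \<delta> k l" using ab by (auto simp: algebra_simps)
    moreover have "v + r *\<^sub>R \<delta> k l \<in> closed_segment v (v + \<delta> k l)" if "0 \<le> r" "r \<le> 1" for r
      unfolding in_segment using that by (intro exI[of _ r]) (simp add: algebra_simps)
    ultimately show "a \<in> closed_segment v (v + \<delta> k l)" "b \<in> closed_segment v (v + \<delta> k l)"
      using \<alpha> \<beta> by auto
  qed
qed
abbreviation A where "A \<equiv> S \<inter> {x. x $ e m = c}"
abbreviation B where "B \<equiv> S \<inter> {x. x $ e 1 = c + real m - 1}"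

text \<open>\<open>\<mu>\<close> and \<open>\<mu> + \<iota>\<close> are the constant points of least
  and greatest value, the points \<open>0\<close> and \<open>n - 1\<close> of
  \<open>F(n)\<close>.\<close>

definition \<mu> :: "real ^ 'n" where "\<mu> = (\<chi> j. if j \<in> e ` {1..m} then c else g j)"

abbreviation \<iota> where "\<iota> \<equiv> lift_dir e m (\<lambda>_. real m - 1)"

lemma \<mu>_in [simp]: "t \<in> {1..m} \<Longrightarrow> \<mu> $ e t = c"
  by (auto simp: \<mu>_def)

lemma \<mu>_out: "j \<notin> e ` {1..m} \<Longrightarrow> \<mu> $ j = g j"
  by (auto simp: \<mu>_def)

lemma \<iota>_in: "t \<in> {1..m} \<Longrightarrow> \<iota> $ e t = real m - 1"
  using lift_dir_in[OF inj] by blast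

lemma EG_const_0: "EG m (\<lambda>_. 0)"
  using EG_peel_lasts[of m m "\<lambda>_. 0"] by (simp add: EG_def)

lemma EG_const_top: "EG m (\<lambda>_. real m - 1)"
  using EG_peel_firsts[of m m "\<lambda>_. real m - 1"] by (simp add: EG_def)

lemma \<mu>_mem: "\<mu> \<in> S" "\<mu> + \<iota> \<in> S"
proof -
  have "EG m (score_seq e c \<mu>) \<longleftrightarrow> EG m (\<lambda>_. 0)"
    by (rule EG_cong) (simp add: score_seq_def)
  then show "\<mu> \<in> S" using EG_const_0 by (simp add: slice_def \<mu>_out)
  have "EG m (score_seq e c (\<mu> + \<iota>)) \<longleftrightarrow> EG m (\<lambda>_. real m - 1)"
    by (rule EG_cong) (simp add: score_seq_def \<iota>_in)
  then show "\<mu> + \<iota> \<in> S" using EG_const_top by (simp add: slice_def \<mu>_out lift_dir_out)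
qed

lemma constant_mem_segment:
  assumes x: "x \<in> S" and const: "\<And>t. t \<in> {1..m} \<Longrightarrow> x $ e t = x $ e 1"
  shows "x \<in> closed_segment \<mu> (\<mu> + \<iota>)"
proof -
  define \<theta> where "\<theta> = (x $ e 1 - c) / (real m - 1)"
  have pos: "real m - 1 > 0" using m by auto
  have "c \<le> x $ e 1" "x $ e 1 \<le> c + real m - 1"
    using slice_bounds[OF x, of 1] m by auto
  then have "0 \<le> \<theta>" "\<theta> \<le> 1" using pos by (auto simp: \<theta>_def)
  moreover have "x = \<mu> + \<theta> *\<^sub>R \<iota>"
  proof (rule vec_eqI)
    fix t assume t: "t \<in> {1..m}"
    then show "x $ e t = (\<mu> + \<theta> *\<^sub>R \<iota>) $ e t"
      using const[OF t] pos by (simp add: \<iota>_in \<theta>_def)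
  qed (use x in \<open>auto simp: slice_def \<mu>_out lift_dir_out\<close>)
  ultimately show ?thesis unfolding in_segment
    by (intro exI[of _ \<theta>]) (simp add: algebra_simps)
qed

text \<open>Any segment in \<open>S\<close> through a point with constant labelled coordinates has
  such ends too, by \<open>EG_const_on_segment\<close>, and all constant points of \<open>S\<close>
  lie on this segment.\<close>

lemma constant_edge: "closed_segment \<mu> (\<mu> + \<iota>) edge_of S"
proof (rule segment_edge_ofI)
  have "\<iota> $ e 1 \<noteq> 0" using \<iota>_in[of 1] m by auto
  then show "\<mu> \<noteq> \<mu> + \<iota>" by (metis add_cancel_right_right zero_index)
  show "closed_segment \<mu> (\<mu> + \<iota>) face_of S"
    unfolding face_of_def
  proof (intro conjI ballI impI convex_closed_segment)
    show "closed_segment \<mu> (\<mu> + \<iota>) \<subseteq> S"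
      by (intro closed_segment_subset convex_slice \<mu>_mem)
  next
    fix a b x
    assume aS: "a \<in> S" and bS: "b \<in> S" and "x \<in> closed_segment \<mu> (\<mu> + \<iota>)" and "x \<in> open_segment a b"
    then obtain \<theta> u where \<theta>: "x = (1 - \<theta>) *\<^sub>R \<mu> + \<theta> *\<^sub>R (\<mu> + \<iota>)"
      and x: "x = (1 - u) *\<^sub>R a + u *\<^sub>R b" and u: "0 < u" "u < 1"
      unfolding in_segment by blast
    have ab: "score_seq e c x t = (1 - u) * score_seq e c a t + u * score_seq e c b t" for t
      unfolding x by (simp add: score_seq_def algebra_simps)
    have "score_seq e c x t = \<theta> * (real m - 1)" if "t \<in> {1..m}" for t
      unfolding \<theta> using that by (simp add: score_seq_def \<iota>_in algebra_simps)
    then have "score_seq e c x 1 = score_seq e c x m" using m by auto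
    note K = EG_const_on_segment[OF EG_seq[OF aS] EG_seq[OF bS] u ab this order_refl order_refl]
    have "a $ e t = a $ e 1" "b $ e t = b $ e 1" if "t \<in> {1..m}" for t
      using K[OF that] by (simp_all add: score_seq_def)
    then show "a \<in> closed_segment \<mu> (\<mu> + \<iota>)" "b \<in> closed_segment \<mu> (\<mu> + \<iota>)"
      by (blast intro: constant_mem_segment aS bS)+
  qed
qed

lemma A_B_disjoint: "A \<inter> B = {}"
  using first_last_faces_disjoint[OF m] by blast

section \<open>Classification of the crossing edges\<close>

text \<open>The midpoint \<open>z\<close> of the edge lies on neither face, so
  \<open>EG_move\<close> moves it both ways. As the edge is a face, it contains these moves and is
  parallel to them; it remains to find its length.\<close>

lemma crossing_edge_cases:
  assumes E: "E edge_of S" and nA: "\<not> E \<subseteq> A" and nB: "\<not> E \<subseteq> B"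
  obtains (blocks) k l v where "1 \<le> k" "1 \<le> l" "k + l \<le> m" "v extreme_point_of V k l"
      "E = closed_segment v (v + \<delta> k l)"
    | (const) "E = closed_segment \<mu> (\<mu> + \<iota>)"
proof -
  have m1: "1 \<le> m" using m by simp
  obtain v u where vu: "v extreme_point_of S" "u extreme_point_of S" "E = closed_segment v u"
    and vm: "v $ e m = c" and u1: "u $ e 1 = c + real m - 1"
  proof -
    obtain p q where pq: "p extreme_point_of S" "q extreme_point_of S" "E = closed_segment p q"
      using edge_of_imp_segment[OF convex_slice compact_slice E] by blast
    have pqS: "p \<in> S" "q \<in> S" using pq by (auto simp: extreme_point_of_def)
    have cA: "convex A" "convex B"
      using face_of_imp_convex[OF last_face[OF m1]] face_of_imp_convex[OF first_face[OF m1]] by auto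
    have "\<not> (p \<in> A \<and> q \<in> A)" "\<not> (p \<in> B \<and> q \<in> B)"
      using nA nB closed_segment_subset[OF _ _ cA(1), of p q] closed_segment_subset[OF _ _ cA(2), of p q] pq(3)
      by blast+
    then consider "p $ e m = c" "q $ e 1 = c + real m - 1" | "q $ e m = c" "p $ e 1 = c + real m - 1"
      using extreme_point_of_slice_cases[OF inj m1 pq(1)] extreme_point_of_slice_cases[OF inj m1 pq(2)] pqS
      by blast
    then show thesis
    proof cases
      case 1
      then show ?thesis using that[OF pq] by simp
    next
      case 2
      then show ?thesis using that[OF pq(2,1)] pq(3) by (simp add: closed_segment_commute)
    qed
  qed
  have vS: "v \<in> S" and uS: "u \<in> S" using vu by (auto simp: extreme_point_of_def)
  define z where "z = midpoint v u"
  have um: "u $ e m > c"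
    using slice_bounds(1)[OF uS, of m] first_last_faces_disjoint[OF m uS] u1 m1 by fastforce
  have v1: "v $ e 1 < c + real m - 1"
    using slice_bounds(2)[OF vS, of 1] first_last_faces_disjoint[OF m vS vm] m1 by fastforce
  have "v \<noteq> u" using um vm by auto
  then have zo: "z \<in> open_segment v u" by (simp add: z_def)
  then have zE: "z \<in> E" using vu(3) open_segment_def by blast
  have zS: "z \<in> S" using zE edge_of_imp_subset[OF E] by blast
  have znth: "z $ j = v $ j / 2 + u $ j / 2" for j
    by (simp add: z_def midpoint_def algebra_simps)
  have Ez: "EG m (score_seq e c z)" using zS by (rule EG_seq)
  have "0 < score_seq e c z m"
    unfolding score_seq_def znth using um vm by linarith
  moreover have "score_seq e c z 1 < real m - 1"
    unfolding score_seq_def znth using v1 u1 by linarith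
  ultimately have nc: "0 < score_seq e c z m" "score_seq e c z 1 < real m - 1" by auto
  have dir: "\<exists>\<tau>. u - v = \<tau> *\<^sub>R lift_dir e m d"
    if "\<epsilon> > 0" "d 1 \<noteq> 0" "EG m (\<lambda>t. score_seq e c z t + \<epsilon> * d t)"
     "EG m (\<lambda>t. score_seq e c z t + (-\<epsilon>) * d t)" for \<epsilon> d
  proof -
    let ?D = "lift_dir e m d"
    have "?D $ e 1 \<noteq> 0" using that m1 by (subst lift_dir_in[OF inj]) auto
    then have "?D \<noteq> 0" by auto
    then have "z \<in> open_segment (z + \<epsilon> *\<^sub>R ?D) (z + (-\<epsilon>) *\<^sub>R ?D)"
      using that by (intro midpoint_of_opposite_steps)
    then have "z + \<epsilon> *\<^sub>R ?D \<in> E"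
      using E zE slice_add_lift_dir[OF inj zS that(3)] slice_add_lift_dir[OF inj zS that(4)]
      unfolding edge_of_def face_of_def by blast
    then obtain w where "z + \<epsilon> *\<^sub>R ?D = (1 - w) *\<^sub>R v + w *\<^sub>R u"
      unfolding vu(3) in_segment by blast
    moreover have "z = (1/2) *\<^sub>R v + (1/2) *\<^sub>R u" by (simp add: z_def midpoint_def algebra_simps)
    ultimately have "\<epsilon> *\<^sub>R ?D = ((1 - w) *\<^sub>R v + w *\<^sub>R u) - ((1/2) *\<^sub>R v + (1/2) *\<^sub>R u)"
      by (metis add_diff_cancel_left')
    also have "\<dots> = (w - 1/2) *\<^sub>R (u - v)"
      by (simp add: vec_eq_iff algebra_simps)
    finally have eq: "\<epsilon> *\<^sub>R ?D = (w - 1/2) *\<^sub>R (u - v)" .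
    have "\<epsilon> *\<^sub>R ?D \<noteq> 0" using \<open>?D \<noteq> 0\<close> that(1) by simp
    then have "w - 1/2 \<noteq> 0" unfolding eq by (metis scaleR_zero_left)
    then have "u - v = (1 / (w - 1/2)) *\<^sub>R (\<epsilon> *\<^sub>R ?D)" unfolding eq by simp
    then show ?thesis by (metis scaleR_scaleR)
  qed
  show thesis
  proof (rule EG_move[OF Ez m1 nc], goal_cases)
    case (2 \<epsilon>)
    then obtain \<tau> where \<tau>: "u - v = \<tau> *\<^sub>R lift_dir e m (\<lambda>_. 1)" using dir[of \<epsilon> "\<lambda>_. 1"] by auto
    \<comment> \<open>Both \<open>z\<close> and \<open>u - v\<close> are constant, hence so are
      \<open>v\<close> and \<open>u\<close>; their values are known at \<open>e m\<close> and at
      \<open>e 1\<close>.\<close>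
    have vt: "v $ e t = c \<and> u $ e t = c + real m - 1" if t: "t \<in> {1..m}" for t
    proof -
      have step: "u $ e r = v $ e r + \<tau>" if "r \<in> {1..m}" for r
        using arg_cong[OF \<tau>, of "\<lambda>x. x $ e r"] lift_dir_in[OF inj that] by simp
      have zc: "z $ e r = z $ e 1" if "r \<in> {1..m}" for r
        using 2(2)[OF that] by (simp add: score_seq_def)
      have "z $ e t = z $ e m" using zc[OF t] zc[of m] m1 by simp
      moreover have "z $ e t = z $ e 1" by (rule zc[OF t])
      ultimately show ?thesis
        using step[OF t] step[of m] step[of 1] m1 vm u1 by (simp add: znth field_simps)
    qed
    have "v = \<mu>" using vt vS by (intro vec_eqI) (auto simp: slice_def \<mu>_out)
    moreover have "u = \<mu> + \<iota>"
      using vt uS by (intro vec_eqI) (auto simp: slice_def \<mu>_out lift_dir_out \<iota>_in)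
    ultimately show ?case using const vu(3) by simp
  next
    case (1 k l \<epsilon>)
    note kl = 1(1-3)
    have "block_dir m k l 1 \<noteq> 0" using kl by (simp add: block_dir_def)
    then obtain \<tau> where \<tau>: "u - v = \<tau> *\<^sub>R \<delta> k l" using dir[of \<epsilon>] 1 by blast
    have step: "u $ e t = v $ e t + \<tau> * block_dir m k l t" if "t \<in> {1..m}" for t
      using arg_cong[OF \<tau>, of "\<lambda>x. x $ e t"] \<delta>_nth[OF that, of k l] by simp
    have zK: "z $ e t = z $ e 1" if "t \<in> {1..k}" for t
      using 1(6)[OF that] by (simp add: score_seq_def)
    have zL: "z $ e t = z $ e m" if "t \<in> {m - l + 1..m}" for t
      using 1(7)[OF that] by (simp add: score_seq_def)
    have K: "v $ e t = v $ e 1 \<and> u $ e t = c + real m - 1" if "t \<in> {1..k}" for t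
      using zK[OF that] step[of t] step[of 1] that kl u1 by (simp add: znth block_dir_def field_simps)
    have L: "v $ e t = c \<and> u $ e t = u $ e m" if "t \<in> {m - l + 1..m}" for t
      using zL[OF that] step[of t] step[of m] that kl vm by (auto simp: znth block_dir_def field_simps)
    have v1\<tau>: "v $ e 1 + \<tau> * real l = c + real m - 1"
      using step[of 1] u1 kl by (simp add: block_dir_def)
    have um\<tau>: "u $ e m = c + \<tau> * real k"
      using step[of m] vm kl by (simp add: block_dir_def)
    \<comment> \<open>Being extreme, the ends stay extreme in the smaller slices with the last,
      respectively first, block frozen. There the vertex dichotomy applies once more.\<close>
    have "v \<in> slice e c (fix_last e c g m l) (m - l)"
      using slice_fix_last[OF inj, of l c g] vS L kl by auto
    then have "v extreme_point_of slice e c (fix_last e c g m l) (m - l)"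
      using slice_fix_last[OF inj, of l c g] kl by (intro extreme_point_of_subset[OF vu(1)]) auto
    moreover have "inj_on e {1..m - l}" using inj by (rule inj_on_subset) auto
    ultimately have v_cases: "v $ e (m - l) = c \<or> v $ e 1 = c + real (m - l) - 1"
      using extreme_point_of_slice_cases[of e "m - l" v c] kl by auto
    have "u \<in> slice (\<lambda>t. e (t + k)) (c + real k) (fix_first e c g m k) (m - k)"
      using slice_fix_first[OF inj, of k c g] uS K kl by auto
    then have "u extreme_point_of slice (\<lambda>t. e (t + k)) (c + real k) (fix_first e c g m k) (m - k)"
      using slice_fix_first[OF inj, of k c g] kl by (intro extreme_point_of_subset[OF vu(2)]) auto
    moreover have "1 \<le> m - k" using kl by auto
    ultimately have "u $ e (m - k + k) = c + real k \<or> u $ e (1 + k) = c + real k + real (m - k) - 1"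
      by (rule extreme_point_of_slice_cases[OF inj_on_shift[OF inj], rotated])
    then have u_cases: "u $ e m = c + real k \<or> u $ e (k + 1) = c + real m - 1"
      using kl by (simp add: of_nat_diff add.commute)
    \<comment> \<open>One alternative of each dichotomy amounts to \<open>\<tau> = 1\<close>. If
      both fail, \<open>v\<close> is minimal just before the last block and \<open>u\<close> maximal
      just after the first; then \<open>z\<close> is constant if the blocks meet, and otherwise
      \<open>v\<close> reaches the top value.\<close>
    have "\<tau> = 1"
    proof (rule ccontr)
      assume "\<tau> \<noteq> 1"
      then have "v $ e 1 \<noteq> c + real (m - l) - 1" "u $ e m \<noteq> c + real k"
        using v1\<tau> um\<tau> kl by (auto simp: of_nat_diff)
      then have v0: "v $ e (m - l) = c" and utop: "u $ e (k + 1) = c + real m - 1"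
        using v_cases u_cases by auto
      show False
      proof (cases "k + l = m")
        case True
        then have "v $ e 1 = c" using K[of "m - l"] v0 kl by auto
        moreover have "u $ e m = c + real m - 1"
          using L[of "k + 1"] utop True kl by auto
        ultimately have "z $ e 1 = z $ e m" using vm u1 by (simp add: znth)
        then show False using 1(5) by (simp add: score_seq_def)
      next
        case False
        then have k1: "k + 1 \<in> {1..m}" "\<not> k + 1 \<le> k" "\<not> m - l < k + 1" using kl by auto
        then have "v $ e (k + 1) = c + real m - 1"
          using step[of "k + 1"] utop by (simp add: block_dir_def)
        then have "c + real m - 1 \<le> v $ e 1"
          using EG_mono[OF EG_seq[OF vS], of 1 "k + 1"] k1 by (simp add: score_seq_def)
        then show False using v1 by simp
      qed
    qed
    then have u: "u = v + \<delta> k l" using \<tau> by (simp add: algebra_simps)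
    have "v $ e 1 = c + real m - 1 - real l" using v1\<tau> \<open>\<tau> = 1\<close> by simp
    then have "v \<in> V k l" using K L vS unfolding V_def by auto
    then have "v extreme_point_of V k l"
      by (intro extreme_point_of_subset[OF vu(1)]) (auto simp: V_def)
    then show ?case using blocks kl vu(3) u by blast
  qed
qed

end

section \<open>Counting edges\<close>

text \<open>Truncation makes the term \<open>l = n\<close> equal to \<open>1\<close>, which
  completes the geometric sum to a full power. It corresponds to blocks that cover all positions,
  where \<open>V k l\<close> is a single point.\<close>

lemma sum_truncated_powers: "1 \<le> n \<Longrightarrow> (\<Sum>l = 1..n. 2 ^ (n - l - 1)) = (2::nat) ^ (n - 1)"
proof (induction n rule: nat_induct_at_least)
  case (Suc n)
  have "(\<Sum>l = 1..Suc n. 2 ^ (Suc n - l - 1)) = 2 ^ (n - 1) + (\<Sum>l = Suc 1..Suc n. (2::nat) ^ (Suc n - l - 1))"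
    by (subst sum.atLeast_Suc_atMost) auto
  also have "(\<Sum>l = Suc 1..Suc n. (2::nat) ^ (Suc n - l - 1)) = (\<Sum>l = 1..n. 2 ^ (n - l - 1))"
    by (subst sum.shift_bounds_cl_Suc_ivl) simp
  finally show ?case using Suc by (cases n) auto
qed simp

lemma sum_powers_pred: "(\<Sum>k = 1..<m. (2::nat) ^ (m - k - 1)) = 2 ^ (m - 1) - 1"
proof (induction m)
  case (Suc m)
  show ?case
  proof (cases "m = 0")
    case False
    have "(\<Sum>k = 1..<Suc m. (2::nat) ^ (Suc m - k - 1)) = 2 ^ (m - 1) + (\<Sum>k = Suc 1..<Suc m. 2 ^ (Suc m - k - 1))"
      using False by (subst sum.atLeast_Suc_lessThan) auto
    also have "(\<Sum>k = Suc 1..<Suc m. (2::nat) ^ (Suc m - k - 1)) = (\<Sum>k = 1..<m. 2 ^ (m - k - 1))"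
      by (subst sum.shift_bounds_Suc_ivl) simp
    finally have *: "(\<Sum>k = 1..<Suc m. (2::nat) ^ (Suc m - k - 1)) = 2 ^ (m - 1) + (2 ^ (m - 1) - 1)"
      using Suc by simp
    have "(2::nat) ^ m = 2 ^ (m - 1) + 2 ^ (m - 1)" "(1::nat) \<le> 2 ^ (m - 1)"
      using False by (cases m; simp)+
    then show ?thesis unfolding * by simp
  qed simp
qed simp

context labelled_slice
begin

definition blocks :: "(nat \<times> nat) set" where
  "blocks = {(k, l). 1 \<le> k \<and> 1 \<le> l \<and> k + l \<le> m}"

definition crossing_edges where
  "crossing_edges = {E. E edge_of S \<and> \<not> E \<subseteq> A \<and> \<not> E \<subseteq> B}"

definition block_edges where
  "block_edges = (\<lambda>((k, l), v). closed_segment v (v + \<delta> k l)) `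
    (SIGMA (k, l):blocks. extreme_points (V k l))"

lemma V_ends:
  assumes "(k, l) \<in> blocks" "v \<in> V k l"
  shows "v $ e m = c" "v $ e 1 = c + real m - 1 - real l" "(v + \<delta> k l) $ e m = c + real k"
    "\<delta> k l $ e 1 = real l" "\<delta> k l $ e m = real k"
proof -
  have mem: "m \<in> {m - l + 1..m}" "1 \<in> {1..k}" using assms(1) m by (auto simp: blocks_def)
  show d: "\<delta> k l $ e 1 = real l" "\<delta> k l $ e m = real k"
    using \<delta>_nth[of 1 k l] \<delta>_nth[of m k l] assms(1) m by (auto simp: block_dir_def blocks_def)
  show v: "v $ e m = c" "v $ e 1 = c + real m - 1 - real l"
    using assms(2) mem unfolding V_def by blast+
  show "(v + \<delta> k l) $ e m = c + real k" using v d by simp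
qed

lemma crossing_edges_eq: "crossing_edges = insert (closed_segment \<mu> (\<mu> + \<iota>)) block_edges"
proof
  show "crossing_edges \<subseteq> insert (closed_segment \<mu> (\<mu> + \<iota>)) block_edges"
  proof
    fix E assume "E \<in> crossing_edges"
    then have "E edge_of S" "\<not> E \<subseteq> A" "\<not> E \<subseteq> B" by (auto simp: crossing_edges_def)
    then show "E \<in> insert (closed_segment \<mu> (\<mu> + \<iota>)) block_edges"
    proof (cases rule: crossing_edge_cases)
      case (blocks k l v)
      then have "((k, l), v) \<in> (SIGMA (k, l):blocks. extreme_points (V k l))"
        by (auto simp: blocks_def)
      then show ?thesis using blocks(5) unfolding block_edges_def by force
    qed simp
  qed
  have "closed_segment v (v + \<delta> k l) \<in> crossing_edges"
    if kl: "(k, l) \<in> blocks" and v: "v extreme_point_of V k l" for k l v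
  proof -
    have vV: "v \<in> V k l" using v by (simp add: extreme_point_of_def)
    \<comment> \<open>At \<open>e 1\<close> the point \<open>v\<close> is \<open>l\<close> below the
      top value, and at \<open>e m\<close> the point \<open>v + \<delta> k l\<close> is
      \<open>k\<close> above \<open>c\<close>.\<close>
    have "v \<notin> B" "v + \<delta> k l \<notin> A"
      using V_ends[OF kl vV] kl by (auto simp: blocks_def)
    moreover have "v \<in> closed_segment v (v + \<delta> k l)" "v + \<delta> k l \<in> closed_segment v (v + \<delta> k l)"
      by auto
    ultimately show ?thesis
      using block_edge[OF _ _ _ v] kl unfolding crossing_edges_def blocks_def by blast
  qed
  moreover have "closed_segment \<mu> (\<mu> + \<iota>) \<in> crossing_edges"
  proof -
    have "\<mu> \<notin> B" "\<mu> + \<iota> \<notin> A" using m \<mu>_in[of 1] \<mu>_in[of m] \<iota>_in[of m] by auto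
    moreover have "\<mu> \<in> closed_segment \<mu> (\<mu> + \<iota>)" "\<mu> + \<iota> \<in> closed_segment \<mu> (\<mu> + \<iota>)"
      by auto
    ultimately show ?thesis
      using constant_edge unfolding crossing_edges_def by blast
  qed
  ultimately show "insert (closed_segment \<mu> (\<mu> + \<iota>)) block_edges \<subseteq> crossing_edges"
    unfolding block_edges_def by auto
qed

text \<open>A block edge determines \<open>v\<close> as its end with value \<open>c\<close> at
  \<open>e m\<close>, then \<open>\<delta> k l\<close> as the difference of its ends, and from the
  last and first entries of that the pair \<open>(k, l)\<close>. The count is thus a double sum of
  powers.\<close>

lemma card_block_edges: "finite block_edges \<and> card block_edges = 2 ^ (m - 1) - 1"
proof -
  let ?P = "SIGMA (k, l):blocks. extreme_points (V k l)"
  have bl: "blocks = (SIGMA k:{1..<m}. {1..m - k})"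
    by (auto simp: blocks_def)
  then have fin: "finite blocks" by auto
  have ext: "finite (extreme_points (V k l))" "card (extreme_points (V k l)) = 2 ^ (m - k - l - 1)"
    if "(k, l) \<in> blocks" for k l
    using finite_card_extreme_points_V[of k l] that
    by (auto simp: blocks_def diff_diff_add add.commute)
  have "inj_on (\<lambda>((k, l), v). closed_segment v (v + \<delta> k l)) ?P"
  proof (rule inj_onI)
    fix p q
    assume pq: "p \<in> ?P" "q \<in> ?P" and seg: "(\<lambda>((k, l), v). closed_segment v (v + \<delta> k l)) p =
      (\<lambda>((k, l), v). closed_segment v (v + \<delta> k l)) q"
    obtain k l v k' l' v' where p: "p = ((k, l), v)" and q: "q = ((k', l'), v')"
      by (metis prod.exhaust)
    have kl: "(k, l) \<in> blocks" "(k', l') \<in> blocks"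
      and v: "v extreme_point_of V k l" "v' extreme_point_of V k' l'"
      and eq: "closed_segment v (v + \<delta> k l) = closed_segment v' (v' + \<delta> k' l')"
      using pq seg unfolding p q by auto
    have "v \<in> V k l" "v' \<in> V k' l'" using v by (simp_all add: extreme_point_of_def)
    note ends = V_ends[OF kl(1) this(1)] V_ends[OF kl(2) this(2)]
    have "{v, v + \<delta> k l} = {v', v' + \<delta> k' l'}" using eq by (simp add: closed_segment_eq)
    moreover have "(v' + \<delta> k' l') $ e m \<noteq> c" unfolding ends(8) using kl by (simp add: blocks_def)
    then have "v \<noteq> v' + \<delta> k' l'" using ends(1) by metis
    ultimately have "v = v'" "\<delta> k l = \<delta> k' l'" by (auto simp: doubleton_eq_iff)
    then show "p = q"
      unfolding p q using ends by (metis of_nat_eq_iff)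
  qed
  then have "card block_edges = card ?P"
    unfolding block_edges_def by (rule card_image)
  also have "\<dots> = (\<Sum>p\<in>blocks. card (case p of (k, l) \<Rightarrow> extreme_points (V k l)))"
    using fin ext by (intro card_SigmaI) auto
  also have "\<dots> = (\<Sum>(k, l)\<in>blocks. 2 ^ (m - k - l - 1))"
    using ext by (intro sum.cong) auto
  also have "\<dots> = (\<Sum>k = 1..<m. \<Sum>l = 1..m - k. 2 ^ (m - k - l - 1))"
    unfolding bl by (subst sum.Sigma) auto
  also have "\<dots> = (\<Sum>k = 1..<m. 2 ^ (m - k - 1))"
    by (intro sum.cong refl sum_truncated_powers) auto
  also have "\<dots> = 2 ^ (m - 1) - 1" by (rule sum_powers_pred)
  finally have "card block_edges = 2 ^ (m - 1) - 1" .
  moreover have "finite ?P" using fin ext by (intro finite_SigmaI) auto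
  then have "finite block_edges" unfolding block_edges_def by (rule finite_imageI)
  ultimately show ?thesis by blast
qed

text \<open>The directions \<open>\<iota>\<close> and \<open>\<delta> k l\<close> agree only if
  \<open>k = l = m - 1\<close>. For \<open>m = 2\<close> there is a single block edge and it is the
  constant one, the exception in the count of crossing edges.\<close>

lemma constant_edge_in_block_edges: "closed_segment \<mu> (\<mu> + \<iota>) \<in> block_edges \<longleftrightarrow> m = 2"
proof
  assume "closed_segment \<mu> (\<mu> + \<iota>) \<in> block_edges"
  then obtain k l v where kl: "(k, l) \<in> blocks" and v: "v extreme_point_of V k l"
    and eq: "closed_segment \<mu> (\<mu> + \<iota>) = closed_segment v (v + \<delta> k l)"
    unfolding block_edges_def by auto
  have "v \<in> V k l" using v by (simp add: extreme_point_of_def)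
  note ends = V_ends[OF kl this]
  have "{\<mu>, \<mu> + \<iota>} = {v, v + \<delta> k l}" using eq by (simp add: closed_segment_eq)
  moreover have "(v + \<delta> k l) $ e m \<noteq> c" unfolding ends(3) using kl by (simp add: blocks_def)
  moreover have "\<mu> $ e m = c" using m by (intro \<mu>_in) auto
  ultimately have "\<mu> \<noteq> v + \<delta> k l" "{\<mu>, \<mu> + \<iota>} = {v, v + \<delta> k l}" by metis+
  then have "\<iota> = \<delta> k l" by (auto simp: doubleton_eq_iff)
  then have "real m - 1 = real l" "real m - 1 = real k"
    using ends \<iota>_in[of 1] \<iota>_in[of m] m by auto
  then show "m = 2" using kl m by (auto simp: blocks_def)
next
  assume m2: "m = 2"
  have "card block_edges = 1" using card_block_edges m2 by simp
  then obtain E where E: "E \<in> block_edges" by (metis card_1_singletonE insertI1)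
  then obtain k l v where kl: "(k, l) \<in> blocks" and v: "v extreme_point_of V k l"
    and eq: "E = closed_segment v (v + \<delta> k l)"
    unfolding block_edges_def by auto
  have "1 \<le> k \<and> 1 \<le> l \<and> k + l \<le> m" using kl by (simp add: blocks_def)
  then have "k = 1" "l = 1" using m2 by linarith+
  then have r: "real m - 1 = 1" "real k = 1" "real l = 1" using m2 by simp_all
  have vV: "v \<in> V k l" using v by (simp add: extreme_point_of_def)
  have t12: "t = 1 \<or> t = m" if "t \<in> {1..m}" for t
    using that m2 unfolding atLeastAtMost_iff by linarith
  note ends = V_ends[OF kl vV, unfolded r]
  have "v = \<mu>"
  proof (rule vec_eqI)
    show "v $ e t = \<mu> $ e t" if "t \<in> {1..m}" for t
      using t12[OF that] ends(1,2) r \<mu>_in[OF that] by fastforce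
  qed (use vV in \<open>auto simp: V_def slice_def \<mu>_out\<close>)
  moreover have "\<delta> k l = \<iota>"
  proof (rule vec_eqI)
    show "\<delta> k l $ e t = \<iota> $ e t" if "t \<in> {1..m}" for t
      using t12[OF that] ends(4,5) \<iota>_in[OF that, unfolded r] r by metis
  qed (auto simp: lift_dir_out)
  ultimately show "closed_segment \<mu> (\<mu> + \<iota>) \<in> block_edges" using E eq by simp
qed

lemma card_crossing_edges:
  "finite crossing_edges" "card crossing_edges = (if m = 2 then 1 else 2 ^ (m - 1))"
proof -
  have "(1::nat) \<le> 2 ^ (m - 1)" by simp
  then show "finite crossing_edges" "card crossing_edges = (if m = 2 then 1 else 2 ^ (m - 1))"
    unfolding crossing_edges_eq
    using card_block_edges constant_edge_in_block_edges by (auto simp: card_insert_if)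
qed

lemma edges_eq: "{E. E edge_of S} = {E. E edge_of A} \<union> {E. E edge_of B} \<union> crossing_edges"
  using edge_of_face[OF last_face[of m e c g]] edge_of_face[OF first_face[of m e c g]] m
  by (auto simp: crossing_edges_def)

lemma card_edges:
  assumes "finite {E. E edge_of A}" "finite {E. E edge_of B}"
  shows "finite {E. E edge_of S}"
    "card {E. E edge_of S} = card {E. E edge_of A} + card {E. E edge_of B} + card crossing_edges"
proof -
  have False if "E edge_of A" "E edge_of B" for E
  proof -
    have "E = {}" using that[THEN edge_of_imp_subset] A_B_disjoint by blast
    then show False using that by (simp add: edge_of_def)
  qed
  then have 1: "{E. E edge_of A} \<inter> {E. E edge_of B} = {}" by blast
  have 2: "({E. E edge_of A} \<union> {E. E edge_of B}) \<inter> crossing_edges = {}"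
    using edge_of_imp_subset unfolding crossing_edges_def by blast
  show "finite {E. E edge_of S}"
    unfolding edges_eq using assms card_crossing_edges by simp
  show "card {E. E edge_of S} = card {E. E edge_of A} + card {E. E edge_of B} + card crossing_edges"
    unfolding edges_eq using assms card_crossing_edges 1 2 by (simp add: card_Un_disjoint)
qed

end

lemma no_edge_of_singleton: "\<not> E edge_of {x}"
proof
  assume *: "E edge_of {x}"
  then have "aff_dim E \<le> aff_dim {x}" by (intro aff_dim_subset edge_of_imp_subset)
  then show False using * by (simp add: edge_of_def)
qed

text \<open>From \<open>m = 2\<close> on, passing to \<open>m + 1\<close> doubles the number of
  edges and adds \<open>2 ^ m\<close> crossing ones; the start is the single edge for
  \<open>m = 2\<close>.\<close>

lemma finite_card_edges_slice:
  assumes "inj_on e {1..m}" "1 \<le> m"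
  shows "finite {E. E edge_of slice e c g m} \<and>
    card {E. E edge_of slice e c g m} = (if m = 1 then 0 else 2 ^ (m - 2) * (2 * m - 3))"
  using assms(2,1)
proof (induction m arbitrary: e c g rule: nat_induct_at_least)
  case base
  then show ?case using slice_1[of e c g] by (simp add: no_edge_of_singleton)
next
  case (Suc m)
  interpret labelled_slice e c g "Suc m"
    using Suc by unfold_locales auto
  have A: "slice e c (fix_last e c g (Suc m) 1) m = A"
    using slice_fix_last[OF Suc.prems, of 1 c g] by simp
  have B: "slice (\<lambda>t. e (t + 1)) (c + 1) (fix_first e c g (Suc m) 1) m = B"
    using slice_fix_first[OF Suc.prems, of 1 c g] by simp
  have "inj_on e {1..m}" "inj_on (\<lambda>t. e (t + 1)) {1..m}"
    using Suc.prems inj_on_shift[OF Suc.prems, of 1] by (auto intro: inj_on_subset)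
  note IH = Suc.IH[OF this(1), of c "fix_last e c g (Suc m) 1", unfolded A]
    Suc.IH[OF this(2), of "c + 1" "fix_first e c g (Suc m) 1", unfolded B]
  show ?case
  proof (cases "m = 1")
    case True
    then show ?thesis using IH card_edges card_crossing_edges by auto
  next
    case False
    define j where "j = m - 2"
    then have j: "m = Suc (Suc j)" using False Suc.hyps by arith
    have IHs: "card {E. E edge_of A} = 2 ^ j * (2 * j + 1)" "card {E. E edge_of B} = 2 ^ j * (2 * j + 1)"
      using IH False by (simp_all add: j)
    have "card crossing_edges = 2 ^ Suc (Suc j)"
      using card_crossing_edges(2) by (simp add: j)
    then have "card {E. E edge_of S} = 2 ^ Suc j * (2 * j + 3)"
      using card_edges(2) IH IHs by (simp add: algebra_simps)
    moreover have "Suc m - 2 = Suc j" "2 * Suc m - 3 = 2 * j + 3" "(Suc m = 1) = False"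
      using j by simp_all
    moreover have "finite {E. E edge_of S}" using card_edges(1) IH by blast
    ultimately show ?thesis by simp
  qed
qed

section \<open>Facets\<close>

lemma card_facets_of_irredundant:
  fixes a :: "'i \<Rightarrow> 'a::euclidean_space"
  assumes fin: "finite I" and S: "S = {x. \<forall>i\<in>I. a i \<bullet> x \<le> b i}"
    and z: "\<And>i. i \<in> I \<Longrightarrow> a i \<bullet> z < b i"
    and y: "\<And>i. i \<in> I \<Longrightarrow> b i < a i \<bullet> y i"
    and y': "\<And>i j. i \<in> I \<Longrightarrow> j \<in> I \<Longrightarrow> j \<noteq> i \<Longrightarrow> a j \<bullet> y i \<le> b j"
  shows "card {G. G facet_of S} = card I"
proof -
  define h where "h i = {x. a i \<bullet> x \<le> b i}" for i
  have inj_h: "inj_on h I"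
  proof (rule inj_onI, rule ccontr)
    fix i j assume *: "i \<in> I" "j \<in> I" "h i = h j" "i \<noteq> j"
    then have "y i \<in> h j" using y'[of i j] by (simp add: h_def)
    moreover have "y i \<notin> h i" using *(1) y[of i] by (simp add: h_def)
    ultimately show False using *(3) by blast
  qed
  define r where "r = inv_into I h"
  have r: "r (h i) = i" if "i \<in> I" for i
    using that inj_h by (simp add: r_def inv_into_f_f)
  have "open (\<Inter>i\<in>I. {x. a i \<bullet> x < b i})"
    using fin by (intro open_INT) (auto simp: open_halfspace_lt)
  moreover have "(\<Inter>i\<in>I. {x. a i \<bullet> x < b i}) \<subseteq> S" unfolding S by force
  ultimately have "z \<in> interior S" using z interior_maximal by blast
  then have aff: "affine hull S = UNIV" using affine_hull_nonempty_interior by blast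
  have SF: "S = \<Inter> (h ` I)" unfolding S h_def by auto
  have facet: "C facet_of S \<longleftrightarrow> (\<exists>H. H \<in> h ` I \<and> C = S \<inter> {x. a (r H) \<bullet> x = b (r H)})" for C
  proof (rule facet_of_polyhedron_explicit)
    show "finite (h ` I)" using fin by simp
    show "S = affine hull S \<inter> \<Inter> (h ` I)" using aff SF by simp
    show "a (r H) \<noteq> 0 \<and> H = {x. a (r H) \<bullet> x \<le> b (r H)}" if H: "H \<in> h ` I" for H
    proof -
      obtain i where i: "i \<in> I" "H = h i" using H by blast
      have "a i \<noteq> 0" using z[OF i(1)] y[OF i(1)] by auto
      then show ?thesis using i r by (simp add: h_def)
    qed
    show "S \<subset> affine hull S \<inter> \<Inter> F'" if F': "F' \<subset> h ` I" for F'
    proof -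
      obtain i where i: "i \<in> I" "h i \<notin> F'" using F' by blast
      have "y i \<in> \<Inter> F'"
      proof
        fix H assume "H \<in> F'"
        then obtain j where "j \<in> I" "H = h j" "j \<noteq> i" using F' i by blast
        then show "y i \<in> H" using y'[OF i(1)] by (simp add: h_def)
      qed
      moreover have "y i \<notin> S" using y[OF i(1)] i(1) unfolding S by force
      moreover have "S \<subseteq> \<Inter> F'" unfolding SF using F' by blast
      ultimately show ?thesis using aff by auto
    qed
  qed
  define C where "C i = S \<inter> {x. a i \<bullet> x = b i}" for i
  have "{G. G facet_of S} = C ` I"
    unfolding facet using r by (auto simp: C_def)
  moreover have "inj_on C I"
  proof (rule inj_onI, rule ccontr)
    fix i j assume *: "i \<in> I" "j \<in> I" "C i = C j" "i \<noteq> j"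
    \<comment> \<open>At this parameter the segment from \<open>z\<close> to \<open>y i\<close>
      crosses the hyperplane \<open>i\<close>. All other inequalities are still strict there, so
      distinct indices give distinct facets.\<close>
    define t where "t = (b i - a i \<bullet> z) / (a i \<bullet> y i - a i \<bullet> z)"
    define p where "p = z + t *\<^sub>R (y i - z)"
    have t: "0 < t" "t < 1" using z[of i] y[of i] * by (auto simp: t_def)
    have "t * (a i \<bullet> y i - a i \<bullet> z) = b i - a i \<bullet> z"
      using z[of i] y[of i] * by (simp add: t_def)
    then have pi: "a i \<bullet> p = b i" by (simp add: p_def inner_add_right inner_diff_right)
    have pj: "a k \<bullet> p < b k" if "k \<in> I" "k \<noteq> i" for k
    proof -
      have "a k \<bullet> p = (1 - t) * (a k \<bullet> z) + t * (a k \<bullet> y i)"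
        by (simp add: p_def inner_add_right inner_diff_right algebra_simps)
      also have "\<dots> < (1 - t) * b k + t * b k"
        using t z[of k] y'[of i k] that * by (intro add_less_le_mono mult_strict_left_mono mult_left_mono) auto
      finally show ?thesis by (simp add: algebra_simps)
    qed
    have "p \<in> S" unfolding S using pi pj by fastforce
    then have "p \<in> C j" using pi *(3) by (auto simp: C_def)
    then show False using pj[of j] * by (simp add: C_def)
  qed
  ultimately show ?thesis by (simp add: card_image)
qed

section \<open>The irredundant pairs and their slacks\<close>

definition facet_pairs :: "nat \<Rightarrow> (nat \<times> nat) set" where
  "facet_pairs n = {(k, l). k + l = 1 \<or> (1 \<le> k \<and> 1 \<le> l \<and> (k + l = n \<or> k + l + 3 \<le> n))}"

text \<open>
  The slack of a pair with \<open>k + l = n - 1\<close> is the mean of the slacks of \<open>(k + 1, l)\<close> and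
  \<open>(k, l + 1)\<close>; for \<open>k + l = n - 2\<close> it is a sum of the slack of \<open>(k + 1, l + 1)\<close> and a monotonicity step.
\<close>

lemma EG_of_facet_pairs:
  assumes n: "4 \<le> n"
    and mono: "\<And>t. 1 \<le> t \<Longrightarrow> t < n \<Longrightarrow> s (Suc t) \<le> s t"
    and facets: "\<And>k l. (k, l) \<in> facet_pairs n \<Longrightarrow> 0 \<le> slack n s k l"
  shows "EG n s"
  unfolding EG_def
proof (intro conjI allI impI)
  fix k l assume kl: "k + l \<le> n"
  have s1: "s 1 \<le> real n - 1" and sn: "0 \<le> s n"
    using facets[of 1 0] facets[of 0 1] n by (simp_all add: slack_def facet_pairs_def Suc_diff_Suc)
  have le1: "s t \<le> s 1" if "1 \<le> t" "t \<le> n" for t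
    using that
  proof (induction t rule: nat_induct_at_least)
    case (Suc t)
    then show ?case using mono[of t] by simp
  qed simp
  have gen: "s n \<le> s t" if "1 \<le> t" "t \<le> n" for t
    using that(2,1)
  proof (induction t rule: inc_induct)
    case (step t)
    then show ?case using mono[of t] by simp
  qed simp
  \<comment> \<open>Pairs with a zero entry follow from \<open>(0, 1)\<close>, \<open>(1, 0)\<close>
    and monotonicity. The last two cases are the diagonals that \<open>facet_pairs\<close> leaves
    out.\<close>
  consider "k = 0" | "l = 0" | "1 \<le> k" "1 \<le> l" "k + l = n \<or> k + l + 3 \<le> n"
    | "1 \<le> k" "1 \<le> l" "k + l + 1 = n" | "1 \<le> k" "1 \<le> l" "k + l + 2 = n"
    using kl by linarith
  then show "0 \<le> slack n s k l"
  proof cases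
    case 1
    have "0 \<le> s t" if "t \<in> {n - l + 1..n}" for t
      using gen[of t] sn that by simp
    then have "0 \<le> (\<Sum>t = n - l + 1..n. s t)" by (rule sum_nonneg)
    then show ?thesis using 1 by (simp add: slack_def)
  next
    case 2
    have "s t \<le> real n - 1" if "t \<in> {1..k}" for t
      using le1[of t] s1 that kl by simp
    then have "(\<Sum>t = 1..k. s t) \<le> real (card {1..k}) * (real n - 1)"
      by (rule sum_bounded_above)
    then show ?thesis using 2 by (simp add: slack_def)
  next
    case 3
    then show ?thesis by (intro facets) (auto simp: facet_pairs_def)
  next
    case 4
    then have "(Suc k, l) \<in> facet_pairs n" "(k, Suc l) \<in> facet_pairs n"
      by (auto simp: facet_pairs_def)
    then have "0 \<le> slack n s (Suc k) l" "0 \<le> slack n s k (Suc l)"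
      by (auto intro: facets)
    moreover have "n - l = Suc k" "l < n" "real n = real k + real l + 1" using 4 by auto
    ultimately show ?thesis by (simp add: slack_Suc_left slack_Suc_right)
  next
    case 5
    then have "0 \<le> slack n s (Suc k) (Suc l)"
      by (intro facets) (auto simp: facet_pairs_def)
    moreover have "s (Suc (Suc k)) \<le> s (Suc k)" using 5 by (intro mono) auto
    ultimately show ?thesis using slack_diagonal[of k l n s] 5 by simp
  qed
qed (use mono in blast)

text \<open>
  The degree sequence of the weighted graph with weight \<open>1\<close> inside \<open>K = {1..k}\<close> and between \<open>K\<close>
  and the middle \<open>M\<close>, weight \<open>1/2\<close> inside \<open>M\<close> and between \<open>K\<close> and \<open>L = {n - l + 1..n}\<close>,
  and weight \<open>0\<close> elsewhere. Among the pairs of \<open>facet_pairs n\<close> only \<open>(k, l)\<close> is tight there.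
\<close>

definition half_seq :: "nat \<Rightarrow> nat \<Rightarrow> nat \<Rightarrow> nat \<Rightarrow> real" where
  "half_seq n k l t = (if t \<le> k then real n - 1 - real l / 2 else if n - l < t then real k / 2
     else real k + (real n - real k - real l - 1) / 2)"

text \<open>The margin \<open>1 / 4\<close> is what a perturbation of size
  \<open>1 / (4 * n)\<close> can use up, see \<open>slack_perturb\<close>.\<close>

lemma half_bound:
  fixes a m p :: nat and X :: real
  assumes "0 \<le> X" "1 \<le> a \<and> 3 \<le> m \<or> 1 \<le> p \<and> 1 \<le> X \<and> (a = 0 \<or> 3 \<le> m)"
  shows "1 / 4 \<le> real p * X / 2 + real a * (X + (real m - 1) / 2)"
proof (cases "1 \<le> a \<and> 3 \<le> m")
  case True
  then have "1 * 1 \<le> real a * (X + (real m - 1) / 2)"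
    using assms(1) by (intro mult_mono) (auto simp: field_simps)
  moreover have "0 \<le> real p * X" using assms(1) by simp
  ultimately show ?thesis by linarith
next
  case False
  then have "1 \<le> real p" "1 \<le> X" "a = 0" using assms by auto
  then have "1 * 1 \<le> real p * X" by (intro mult_mono) auto
  with \<open>a = 0\<close> show ?thesis by simp
qed

text \<open>From \<open>4ab \<le> (a + b)^2 \<le> (a + b)m\<close> at least
  \<open>(a + b)(m - 2) / 4\<close> remains.\<close>

lemma quadratic_bound:
  fixes a b m :: nat
  assumes "a + b \<le> m" "1 \<le> a + b" "3 \<le> m"
  shows "1 / 4 \<le> real (a + b) * (real m - 1) / 2 - real a * real b"
proof -
  have "4 * (real a * real b) \<le> (real a + real b) * (real a + real b)"
    using zero_le_power2[of "real a - real b"] by (simp add: power2_eq_square algebra_simps)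
  also have "\<dots> \<le> (real a + real b) * real m"
    using assms by (intro mult_left_mono) auto
  finally have "4 * (real a * real b) \<le> (real a + real b) * real m" .
  moreover have "1 * 1 \<le> (real a + real b) * (real m - 2)"
    using assms by (intro mult_mono) auto
  ultimately show ?thesis by (simp add: field_simps)
qed

locale half_graph =
  fixes n k\<^sub>0 l\<^sub>0 m\<^sub>0 :: nat
  assumes n: "n = k\<^sub>0 + m\<^sub>0 + l\<^sub>0" and n4: "4 \<le> n"
    and pair: "(k\<^sub>0, l\<^sub>0) = (0, 0) \<or> (k\<^sub>0, l\<^sub>0) \<in> facet_pairs n"
begin

abbreviation s where "s \<equiv> half_seq n k\<^sub>0 l\<^sub>0"

lemma real_n: "real n = real k\<^sub>0 + real m\<^sub>0 + real l\<^sub>0"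
  using n by simp

text \<open>A middle of size one or two would create further tight pairs: the formula in
  \<open>slack_6\<close> vanishes at \<open>a = 1\<close>, \<open>b = 0\<close>, respectively at
  \<open>a = b = 1\<close>.\<close>

lemma middle: "3 \<le> m\<^sub>0 \<or> (m\<^sub>0 = 0 \<and> 1 \<le> k\<^sub>0 \<and> 1 \<le> l\<^sub>0)"
  using pair n n4 by (auto simp: facet_pairs_def)

lemma slack_1:
  assumes "k \<le> k\<^sub>0" "l \<le> l\<^sub>0"
  shows "slack n s k l = (real k * (real l\<^sub>0 - real l) + real l * (real k\<^sub>0 - real k)) / 2"
proof -
  have "slack n s k l = real k * (real n - 1 - real l) - real k * (real n - 1 - real l\<^sub>0 / 2) + real l * (real k\<^sub>0 / 2)"
    by (rule slack_blocks) (use assms n in \<open>auto simp: half_seq_def\<close>)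
  then show ?thesis by (simp add: field_simps)
qed

lemma slack_2:
  assumes "a \<le> m\<^sub>0" "l \<le> l\<^sub>0"
  shows "slack n s (k\<^sub>0 + a) l = real k\<^sub>0 * (real l\<^sub>0 - real l) / 2
    + real a * (real l\<^sub>0 - real l + (real m\<^sub>0 - 1) / 2)"
  using assms(1)
proof (induction a)
  case 0
  then show ?case using slack_1[of k\<^sub>0 l] assms by simp
next
  case (Suc a)
  then have "s (Suc (k\<^sub>0 + a)) = real k\<^sub>0 + (real m\<^sub>0 - 1) / 2"
    using n by (simp add: half_seq_def)
  then show ?case using Suc by (simp add: slack_Suc_left real_n field_simps)
qed

text \<open>Past the middle each step adds \<open>n - 1 - l\<close> and subtracts an entry
  \<open>k\<^sub>0 / 2\<close>, which is no larger.\<close>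

lemma slack_3:
  assumes "k\<^sub>0 + m\<^sub>0 + a + l \<le> n"
  shows "slack n s (k\<^sub>0 + m\<^sub>0) l \<le> slack n s (k\<^sub>0 + m\<^sub>0 + a) l"
  using assms
proof (induction a)
  case (Suc a)
  then have "s (Suc (k\<^sub>0 + m\<^sub>0 + a)) = real k\<^sub>0 / 2" "real k\<^sub>0 + real m\<^sub>0 + real a + 1 + real l \<le> real n"
    using n by (auto simp: half_seq_def)
  then show ?case using Suc by (simp add: slack_Suc_left)
qed simp

lemma slack_4:
  assumes "k \<le> k\<^sub>0" "b \<le> m\<^sub>0"
  shows "slack n s k (l\<^sub>0 + b) = real l\<^sub>0 * (real k\<^sub>0 - real k) / 2
    + real b * (real k\<^sub>0 - real k + (real m\<^sub>0 - 1) / 2)"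
  using assms(2)
proof (induction b)
  case 0
  then show ?case using slack_1[of k l\<^sub>0] assms by simp
next
  case (Suc b)
  then have "s (n - (l\<^sub>0 + b)) = real k\<^sub>0 + (real m\<^sub>0 - 1) / 2" "l\<^sub>0 + b < n"
    using n by (auto simp: half_seq_def)
  then show ?case using Suc by (simp add: slack_Suc_right field_simps)
qed

lemma slack_5:
  assumes "k + (l\<^sub>0 + m\<^sub>0 + b) \<le> n"
  shows "slack n s k (l\<^sub>0 + m\<^sub>0) \<le> slack n s k (l\<^sub>0 + m\<^sub>0 + b)"
  using assms
proof (induction b)
  case (Suc b)
  then have "s (n - (l\<^sub>0 + m\<^sub>0 + b)) = real n - 1 - real l\<^sub>0 / 2" "l\<^sub>0 + m\<^sub>0 + b < n"
    "real k + real l\<^sub>0 + real m\<^sub>0 + real b + 1 \<le> real n"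
    using n by (auto simp: half_seq_def)
  then show ?case using Suc by (simp add: slack_Suc_right)
qed simp

lemma slack_6:
  assumes "a + b \<le> m\<^sub>0"
  shows "slack n s (k\<^sub>0 + a) (l\<^sub>0 + b) = real (a + b) * (real m\<^sub>0 - 1) / 2 - real a * real b"
  using assms
proof (induction a)
  case 0
  then show ?case using slack_4[of k\<^sub>0 b] by simp
next
  case (Suc a)
  then have "s (Suc (k\<^sub>0 + a)) = real k\<^sub>0 + (real m\<^sub>0 - 1) / 2"
    using n by (simp add: half_seq_def)
  then show ?case using Suc by (simp add: slack_Suc_left real_n field_simps)
qed

lemma slack_lower_bound:
  assumes kl: "k + l \<le> n" "(k, l) \<noteq> (0, 0)" "(k, l) \<noteq> (k\<^sub>0, l\<^sub>0)"
  shows "1 / 4 \<le> slack n s k l"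
proof -
  have k0l0: "(k\<^sub>0 = 0 \<and> l\<^sub>0 = 0) \<or> (k\<^sub>0 = 1 \<and> l\<^sub>0 = 0) \<or> (k\<^sub>0 = 0 \<and> l\<^sub>0 = 1) \<or> (1 \<le> k\<^sub>0 \<and> 1 \<le> l\<^sub>0)"
    using pair by (auto simp: facet_pairs_def)
  \<comment> \<open>The cases record how far the first \<open>k\<close> and the last
    \<open>l\<close> positions reach into the three blocks. Beyond the middle,
    \<open>k + l \<le> n\<close> forces the other number to be below its block size.\<close>
  consider "k \<le> k\<^sub>0" "l \<le> l\<^sub>0" | "k\<^sub>0 < k" "k \<le> k\<^sub>0 + m\<^sub>0" "l \<le> l\<^sub>0" | "k\<^sub>0 + m\<^sub>0 < k" "l < l\<^sub>0"
    | "l\<^sub>0 < l" "l \<le> l\<^sub>0 + m\<^sub>0" "k \<le> k\<^sub>0" | "l\<^sub>0 + m\<^sub>0 < l" "k < k\<^sub>0" | "k\<^sub>0 < k" "l\<^sub>0 < l"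
    using kl(1) n by linarith
  then show ?thesis
  proof cases
    case 1
    \<comment> \<open>Twice the slack is a natural number here. It vanishes only at the two excluded
      pairs, where \<open>k0l0\<close> handles the graphs with an empty block.\<close>
    have "1 \<le> k * (l\<^sub>0 - l) + l * (k\<^sub>0 - k)"
    proof (rule ccontr)
      assume "\<not> ?thesis"
      then have "k * (l\<^sub>0 - l) = 0" "l * (k\<^sub>0 - k) = 0" by linarith+
      then have "(k = 0 \<or> l = l\<^sub>0) \<and> (l = 0 \<or> k = k\<^sub>0)" using 1 by auto
      then show False using kl k0l0 1 by auto
    qed
    then have "real 1 \<le> real (k * (l\<^sub>0 - l) + l * (k\<^sub>0 - k))" by (rule of_nat_mono)
    then show ?thesis using 1 by (simp add: slack_1 of_nat_diff)
  next
    case 2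
    then obtain a where a: "k = k\<^sub>0 + a" "1 \<le> a" "a \<le> m\<^sub>0"
      by (metis add_le_cancel_left less_eqE less_or_eq_imp_le nat_add_left_cancel_less
          Suc_leI One_nat_def add_0_right)
    then have "3 \<le> m\<^sub>0" using middle by auto
    then show ?thesis unfolding a(1) slack_2[OF a(3) 2(3)]
      using a 2 by (intro half_bound) auto
  next
    case 3
    then obtain a where a: "k = k\<^sub>0 + m\<^sub>0 + a" by (metis less_imp_add_positive)
    have "1 \<le> m\<^sub>0 \<and> 3 \<le> m\<^sub>0 \<or> 1 \<le> k\<^sub>0 \<and> 1 \<le> real l\<^sub>0 - real l \<and> (m\<^sub>0 = 0 \<or> 3 \<le> m\<^sub>0)"
      using 3 middle by auto
    then have "1 / 4 \<le> slack n s (k\<^sub>0 + m\<^sub>0) l"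
      unfolding slack_2[OF order_refl less_imp_le[OF 3(2)]] by (rule half_bound[rotated]) (use 3 in simp)
    also have "\<dots> \<le> slack n s k l" using slack_3[of a l] kl a by simp
    finally show ?thesis .
  next
    case 4
    then obtain b where b: "l = l\<^sub>0 + b" "1 \<le> b" "b \<le> m\<^sub>0"
      by (metis add_le_cancel_left less_eqE less_or_eq_imp_le nat_add_left_cancel_less
          Suc_leI One_nat_def add_0_right)
    then have "3 \<le> m\<^sub>0" using middle by auto
    then show ?thesis unfolding b(1) slack_4[OF 4(3) b(3)]
      using b 4 by (intro half_bound) auto
  next
    case 5
    then obtain b where b: "l = l\<^sub>0 + m\<^sub>0 + b" by (metis less_imp_add_positive)
    have "1 \<le> m\<^sub>0 \<and> 3 \<le> m\<^sub>0 \<or> 1 \<le> l\<^sub>0 \<and> 1 \<le> real k\<^sub>0 - real k \<and> (m\<^sub>0 = 0 \<or> 3 \<le> m\<^sub>0)"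
      using 5 middle by auto
    then have "1 / 4 \<le> slack n s k (l\<^sub>0 + m\<^sub>0)"
      unfolding slack_4[OF less_imp_le[OF 5(2)] order_refl] by (rule half_bound[rotated]) (use 5 in simp)
    also have "\<dots> \<le> slack n s k l" using slack_5[of k b] kl b by simp
    finally show ?thesis .
  next
    case 6
    then obtain a b where ab: "k = k\<^sub>0 + a" "l = l\<^sub>0 + b" "1 \<le> a" "1 \<le> b"
      using less_imp_add_positive[of k\<^sub>0 k] less_imp_add_positive[of l\<^sub>0 l] by force
    then have le: "a + b \<le> m\<^sub>0" using kl(1) n by auto
    then have "3 \<le> m\<^sub>0" using middle ab by auto
    then show ?thesis unfolding ab slack_6[OF le] using le ab by (intro quadratic_bound) auto
  qed
qed

end

text \<open>The slack involves \<open>k + l\<close> entries with coefficients \<open>1\<close> or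
  \<open>-1\<close>, each of them off by at most \<open>\<eta>\<close>.\<close>

lemma slack_perturb:
  assumes kl: "k + l \<le> n" and y: "\<And>t. t \<in> {1..n} \<Longrightarrow> \<bar>y t - s t\<bar> \<le> \<eta>" and "0 \<le> \<eta>"
  shows "slack n s k l - real n * \<eta> \<le> slack n y k l"
proof -
  have "y t \<le> s t + \<eta>" if "t \<in> {1..k}" for t
    using y[of t] that kl by (auto simp: abs_le_iff)
  then have "(\<Sum>t = 1..k. y t) \<le> (\<Sum>t = 1..k. s t + \<eta>)" by (rule sum_mono)
  then have 1: "(\<Sum>t = 1..k. y t) \<le> (\<Sum>t = 1..k. s t) + real k * \<eta>" by (simp add: sum.distrib)
  have "s t - \<eta> \<le> y t" if "t \<in> {n - l + 1..n}" for t
    using y[of t] that by (auto simp: abs_le_iff)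
  then have "(\<Sum>t = n - l + 1..n. s t - \<eta>) \<le> (\<Sum>t = n - l + 1..n. y t)" by (rule sum_mono)
  then have 2: "(\<Sum>t = n - l + 1..n. s t) - real l * \<eta> \<le> (\<Sum>t = n - l + 1..n. y t)"
    using kl by (simp add: sum_subtractf)
  have "(real k + real l) * \<eta> \<le> real n * \<eta>"
    using kl assms(3) by (intro mult_right_mono) auto
  then show ?thesis using 1 2 by (simp add: slack_def algebra_simps)
qed

lemma card_facet_pairs:
  assumes "4 \<le> n"
  shows "finite (facet_pairs n)" "real (card (facet_pairs n)) = (real n ^ 2 - 5 * real n + 14) / 2"
proof -
  \<comment> \<open>\<open>D\<close> is the diagonal \<open>k + l = n\<close> and \<open>T\<close>
    the triangle \<open>k + l \<le> n - 3\<close>. The bound \<open>n - 4 + 1 - k\<close> is written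
    so that reversing the sum over \<open>k\<close> gives Gauss' sum up to
    \<open>n - 4\<close>.\<close>
  define D where "D = (\<lambda>k. (k, n - k)) ` {1..<n}"
  define T where "T = (SIGMA k:{1..n - 4}. {1..n - 4 + 1 - k})"
  have eq: "facet_pairs n = {(0, 1), (1, 0)} \<union> D \<union> T"
  proof -
    have "(k, l) \<in> facet_pairs n \<longleftrightarrow> (k, l) \<in> {(0, 1), (1, 0)} \<union> D \<union> T" for k l
      using assms by (auto simp: facet_pairs_def D_def T_def image_iff)
    then show ?thesis by auto
  qed
  have fin: "finite D" "finite T" by (auto simp: D_def T_def)
  then show "finite (facet_pairs n)" unfolding eq by simp
  have "{(0, 1), (1, 0)} \<inter> (D \<union> T) = {}" "D \<inter> T = {}"
    using assms by (auto simp: D_def T_def)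
  then have "card (facet_pairs n) = card {(0::nat, 1::nat), (1, 0)} + (card D + card T)"
    unfolding eq Un_assoc using fin by (subst card_Un_disjoint) (auto simp: card_Un_disjoint)
  moreover have "card D = n - 1"
    unfolding D_def by (subst card_image) (auto simp: inj_on_def)
  moreover have "real (card T) = real (n - 4) * (real (n - 4) + 1) / 2"
  proof -
    define N where "N = n - 4"
    have "card T = (\<Sum>k = 1..N. N + 1 - k)"
      by (simp add: T_def N_def)
    also have "\<dots> = (\<Sum>k = 1..N. k)"
      by (subst sum.atLeastAtMost_rev) (auto intro!: sum.cong)
    also have "\<dots> = N * (N + 1) div 2"
      using gauss_sum_from_Suc_0[of N, where ?'a = nat] by simp
    finally show ?thesis
      unfolding N_def[symmetric] by (simp add: real_of_nat_div algebra_simps)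
  qed
  ultimately have "real (card (facet_pairs n)) = 2 + (real n - 1) + (real n - 4) * (real n - 4 + 1) / 2"
    using assms by (simp add: of_nat_diff)
  then show "real (card (facet_pairs n)) = (real n ^ 2 - 5 * real n + 14) / 2"
    by (simp add: power2_eq_square field_simps)
qed

datatype facet_index = Step nat | Block nat nat

definition facet_indices :: "nat \<Rightarrow> facet_index set" where
  "facet_indices n = Step ` {1..<n} \<union> (\<lambda>(k, l). Block k l) ` facet_pairs n"

section \<open>Facets of the polytope and their witnesses\<close>

locale coordinates =
  fixes e :: "nat \<Rightarrow> 'n::finite" and n :: nat
  assumes card: "CARD('n) = n" and n4: "4 \<le> n" and bij: "bij_betw e {1..n} UNIV"
begin

lemma inj_e: "inj_on e {1..n}" and range_e: "e ` {1..n} = UNIV"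
  using bij by (auto simp: bij_betw_def)

lemma F_polytope_iff: "x \<in> F_polytope e \<longleftrightarrow> EG n (\<lambda>t. x $ e t)"
proof -
  have "(\<forall>k l. 1 \<le> k + l \<and> k + l \<le> n \<longrightarrow> 0 \<le> slack n (\<lambda>t. x $ e t) k l) \<longleftrightarrow>
      (\<forall>k l. k + l \<le> n \<longrightarrow> 0 \<le> slack n (\<lambda>t. x $ e t) k l)"
    by (metis One_nat_def Suc_leI add_is_0 neq0_conv order_refl slack_0_0)
  then show ?thesis
    unfolding F_polytope_def EG_def card slack_def by (auto simp: algebra_simps)
qed

lemma F_polytope_eq_slice: "F_polytope e = slice e 0 (\<lambda>_. 0) n"
proof -
  have "score_seq e 0 x = (\<lambda>t. x $ e t)" for x by (simp add: score_seq_def fun_eq_iff)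
  then show ?thesis unfolding slice_def range_e by (auto simp: F_polytope_iff)
qed

fun facet_normal :: "facet_index \<Rightarrow> real ^ 'n" where
  "facet_normal (Step t) = axis (e (Suc t)) 1 - axis (e t) 1"
| "facet_normal (Block k l) = (\<Sum>t = 1..k. axis (e t) 1) - (\<Sum>t = n - l + 1..n. axis (e t) 1)"

declare facet_normal.simps [simp del]

fun facet_bound :: "facet_index \<Rightarrow> real" where
  "facet_bound (Step t) = 0"
| "facet_bound (Block k l) = real k * (real n - 1 - real l)"

lemma inner_facet_normal_Step: "facet_normal (Step t) \<bullet> x = x $ e (Suc t) - x $ e t"
  by (simp add: facet_normal.simps inner_diff_left inner_axis')

lemma inner_facet_normal_Pair:
  "facet_normal (Block k l) \<bullet> x = facet_bound (Block k l) - slack n (\<lambda>t. x $ e t) k l"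
  by (simp add: facet_normal.simps inner_diff_left inner_sum_left inner_axis' slack_def)

lemma F_polytope_eq_halfspaces:
  "F_polytope e = {x. \<forall>i\<in>facet_indices n. facet_normal i \<bullet> x \<le> facet_bound i}"
proof -
  have "EG n (\<lambda>t. x $ e t) \<longleftrightarrow> (\<forall>i\<in>facet_indices n. facet_normal i \<bullet> x \<le> facet_bound i)" for x
  proof
    assume E: "EG n (\<lambda>t. x $ e t)"
    have "facet_normal (Step t) \<bullet> x \<le> facet_bound (Step t)" if "t \<in> {1..<n}" for t
      unfolding inner_facet_normal_Step using E that by (simp add: EG_def)
    moreover have "facet_normal (Block k l) \<bullet> x \<le> facet_bound (Block k l)" if "(k, l) \<in> facet_pairs n" for k l
      unfolding inner_facet_normal_Pair using EG_slack[OF E, of k l] that n4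
      by (auto simp: facet_pairs_def)
    ultimately show "\<forall>i\<in>facet_indices n. facet_normal i \<bullet> x \<le> facet_bound i"
      by (auto simp: facet_indices_def)
  next
    assume H: "\<forall>i\<in>facet_indices n. facet_normal i \<bullet> x \<le> facet_bound i"
    show "EG n (\<lambda>t. x $ e t)"
    proof (rule EG_of_facet_pairs[OF n4])
      fix t assume "1 \<le> t" "t < n"
      then have "Step t \<in> facet_indices n" by (auto simp: facet_indices_def)
      then have "facet_normal (Step t) \<bullet> x \<le> facet_bound (Step t)" using H by blast
      then show "x $ e (Suc t) \<le> x $ e t" unfolding inner_facet_normal_Step by simp
    next
      fix k l assume "(k, l) \<in> facet_pairs n"
      then have "Block k l \<in> facet_indices n" by (force simp: facet_indices_def)
      then have "facet_normal (Block k l) \<bullet> x \<le> facet_bound (Block k l)" using H by blast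
      then show "0 \<le> slack n (\<lambda>t. x $ e t) k l" unfolding inner_facet_normal_Pair by simp
    qed
  qed
  then show ?thesis by (auto simp: F_polytope_iff)
qed

lemma slack_lift_dir: "k + l \<le> n \<Longrightarrow> slack n (\<lambda>t. lift_dir e n s $ e t) k l = slack n s k l"
  by (intro slack_cong lift_dir_in inj_e)

lemma facet_pairs_le: "(k, l) \<in> facet_pairs n \<Longrightarrow> k + l \<le> n"
  using n4 by (auto simp: facet_pairs_def)

lemma facet_normal_lift_Step:
  "t \<in> {1..<n} \<Longrightarrow> facet_normal (Step t) \<bullet> lift_dir e n s = s (Suc t) - s t"
  unfolding inner_facet_normal_Step using lift_dir_in[OF inj_e, of t s] lift_dir_in[OF inj_e, of "Suc t" s]
  by auto

lemma facet_normal_lift_Pair: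
  "(k, l) \<in> facet_pairs n \<Longrightarrow>
    facet_normal (Block k l) \<bullet> lift_dir e n s = facet_bound (Block k l) - slack n s k l"
  unfolding inner_facet_normal_Pair using slack_lift_dir facet_pairs_le by simp

text \<open>A small slope makes the constant sequence strictly decreasing. Entries change by at most
  \<open>1 / (8 * n)\<close>, so half of the margin \<open>1 / 4\<close> is left.\<close>

definition strict_seq :: "nat \<Rightarrow> real" where
  "strict_seq t = half_seq n 0 0 t - real t / (8 * real n ^ 2)"

text \<open>The perturbation reverses the order at \<open>r\<close> and \<open>r + 1\<close> but at
  no other step; its size uses up at most the margin \<open>1 / 4\<close>, so no slack in
  \<open>facet_pairs n\<close> becomes negative.\<close>

definition step_seq :: "nat \<Rightarrow> nat \<Rightarrow> real" where
  "step_seq r t = half_seq n 0 0 t + (if t = r then - 1 else if t = Suc r then 1 else 0) / (4 * real n)"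

text \<open>Raising the first block and lowering the last pushes the tight pair
  \<open>(k, l)\<close> below zero by \<open>(k + l) / (4 * n)\<close>, while the other facet pairs
  lose at most their margin \<open>1 / 4\<close>.\<close>

definition pair_seq :: "nat \<Rightarrow> nat \<Rightarrow> nat \<Rightarrow> real" where
  "pair_seq k l t = half_seq n k l t + (if t \<le> k then 1 else if n - l < t then - 1 else 0) / (4 * real n)"

fun facet_witness :: "facet_index \<Rightarrow> real ^ 'n" where
  "facet_witness (Step r) = lift_dir e n (step_seq r)"
| "facet_witness (Block k l) = lift_dir e n (pair_seq k l)"

lemma half_seq_0: "1 \<le> t \<Longrightarrow> t \<le> n \<Longrightarrow> half_seq n 0 0 t = (real n - 1) / 2"
  by (simp add: half_seq_def)

lemma half_graph_0: "half_graph n 0 0 n"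
  using n4 by unfold_locales auto

lemma half_graph_pair: "(k, l) \<in> facet_pairs n \<Longrightarrow> half_graph n k l (n - k - l)"
  using n4 facet_pairs_le[of k l] by unfold_locales auto

lemma slack_step_seq:
  assumes "(k, l) \<in> facet_pairs n" shows "0 \<le> slack n (step_seq r) k l"
proof -
  have "slack n (half_seq n 0 0) k l - real n * (1 / (4 * real n)) \<le> slack n (step_seq r) k l"
    by (rule slack_perturb[OF facet_pairs_le[OF assms]]) (auto simp: step_seq_def)
  moreover have "1 / 4 \<le> slack n (half_seq n 0 0) k l"
  proof -
    have "(k, l) \<noteq> (0, 0)" using assms by (auto simp: facet_pairs_def)
    then show ?thesis
      using half_graph.slack_lower_bound[OF half_graph_0 facet_pairs_le[OF assms]] by blast
  qed
  ultimately show ?thesis using n4 by simp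
qed

lemma slack_strict_seq:
  assumes "(k, l) \<in> facet_pairs n" shows "0 < slack n strict_seq k l"
proof -
  have "slack n (half_seq n 0 0) k l - real n * (1 / (8 * real n)) \<le> slack n strict_seq k l"
  proof (rule slack_perturb[OF facet_pairs_le[OF assms]])
    fix t assume "t \<in> {1..n}"
    then show "\<bar>strict_seq t - half_seq n 0 0 t\<bar> \<le> 1 / (8 * real n)"
      by (simp add: strict_seq_def power2_eq_square field_simps)
  qed simp
  moreover have "1 / 4 \<le> slack n (half_seq n 0 0) k l"
  proof -
    have "(k, l) \<noteq> (0, 0)" using assms by (auto simp: facet_pairs_def)
    then show ?thesis
      using half_graph.slack_lower_bound[OF half_graph_0 facet_pairs_le[OF assms]] by blast
  qed
  ultimately show ?thesis using n4 by simp
qed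

lemma slack_pair_seq_other:
  assumes "(k, l) \<in> facet_pairs n" "(i, j) \<in> facet_pairs n" "(i, j) \<noteq> (k, l)"
  shows "0 \<le> slack n (pair_seq k l) i j"
proof -
  have "slack n (half_seq n k l) i j - real n * (1 / (4 * real n)) \<le> slack n (pair_seq k l) i j"
    by (rule slack_perturb[OF facet_pairs_le[OF assms(2)]]) (auto simp: pair_seq_def)
  moreover have "1 / 4 \<le> slack n (half_seq n k l) i j"
  proof -
    have "(i, j) \<noteq> (0, 0)" using assms(2) by (auto simp: facet_pairs_def)
    then show ?thesis
      using half_graph.slack_lower_bound[OF half_graph_pair[OF assms(1)] facet_pairs_le[OF assms(2)]] assms(3)
      by blast
  qed
  ultimately show ?thesis using n4 by simp
qed

lemma slack_pair_seq:
  assumes kl: "(k, l) \<in> facet_pairs n"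
  shows "slack n (pair_seq k l) k l < 0"
proof -
  define d where "d = 1 / (4 * real n)"
  have le: "k + l \<le> n" using facet_pairs_le[OF kl] .
  have "slack n (pair_seq k l) k l = real k * (real n - 1 - real l)
      - real k * (real n - 1 - real l / 2 + d) + real l * (real k / 2 - d)"
    by (rule slack_blocks[OF le]) (use le in \<open>auto simp: pair_seq_def half_seq_def d_def\<close>)
  also have "\<dots> = - ((real k + real l) * d)" by (simp add: algebra_simps)
  also have "\<dots> < 0"
  proof -
    have "0 < real (k + l)" "0 < d" using kl n4 by (auto simp: facet_pairs_def d_def)
    then have "0 < (real k + real l) * d" using mult_pos_pos by fastforce
    then show ?thesis by simp
  qed
  finally show ?thesis .
qed

text \<open>Where blocks meet, \<open>half_seq\<close> drops by \<open>(n - k - 1) / 2\<close> into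
  the middle and by \<open>(n - l - 1) / 2\<close> out of it, or by \<open>n / 2 - 1\<close> if the
  middle is empty; the perturbation enlarges these drops.\<close>

lemma pair_seq_decreasing:
  assumes "(k, l) \<in> facet_pairs n" "t \<in> {1..<n}"
  shows "pair_seq k l (Suc t) \<le> pair_seq k l t"
proof -
  have le: "real k + real l \<le> real n" "4 \<le> real n"
    using facet_pairs_le[OF assms(1)] n4 by auto
  have kl: "k + l + 3 \<le> n \<or> k + l = n"
    using assms(1) n4 by (auto simp: facet_pairs_def)
  consider "Suc t \<le> k" | "t = k" "k < n - l" | "t = k" "n - l < Suc k" | "k < t" "Suc t \<le> n - l"
    | "k < t" "t = n - l" | "k < t" "n - l < t"
    by linarith
  then have "half_seq n k l (Suc t) \<le> half_seq n k l t"
  proof cases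
    case 2
    then have "real k + real l + 3 \<le> real n" using kl by linarith
    then show ?thesis using 2 by (auto simp: half_seq_def field_simps)
  next
    case 3
    then show ?thesis using le by (auto simp: half_seq_def field_simps)
  next
    case 5
    then have "real k + real l + 3 \<le> real n" using kl by linarith
    then show ?thesis using 5 by (auto simp: half_seq_def field_simps)
  qed (auto simp: half_seq_def)
  moreover have "(if Suc t \<le> k then 1 else if n - l < Suc t then - 1 else 0) / (4 * real n)
      \<le> (if t \<le> k then 1 else if n - l < t then - 1 else 0) / (4 * real n)"
    by (intro divide_right_mono) auto
  ultimately show ?thesis unfolding pair_seq_def by (rule add_mono)
qed

lemma card_facets_F_polytope:
  "real (card {G. G facet_of F_polytope e}) = (real n ^ 2 - 3 * real n + 12) / 2"
proof -
  have fin: "finite (facet_indices n)"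
    using card_facet_pairs[OF n4] by (simp add: facet_indices_def)
  have "card {G. G facet_of F_polytope e} = card (facet_indices n)"
  proof (rule card_facets_of_irredundant[where z = "lift_dir e n strict_seq" and y = facet_witness,
        OF fin F_polytope_eq_halfspaces])
    fix i assume i: "i \<in> facet_indices n"
    then consider r where "i = Step r" "r \<in> {1..<n}" | k l where "i = Block k l" "(k, l) \<in> facet_pairs n"
      by (auto simp: facet_indices_def)
    note i_cases = this
    show "facet_normal i \<bullet> lift_dir e n strict_seq < facet_bound i"
    proof (cases rule: i_cases)
      case (1 r)
      then show ?thesis unfolding 1(1) facet_normal_lift_Step[OF 1(2)]
        by (simp add: strict_seq_def half_seq_0 field_simps)
    next
      case (2 k l)
      then show ?thesis unfolding 2(1) facet_normal_lift_Pair[OF 2(2)]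
        using slack_strict_seq[OF 2(2)] by simp
    qed
    show "facet_bound i < facet_normal i \<bullet> facet_witness i"
    proof (cases rule: i_cases)
      case (1 r)
      then show ?thesis unfolding 1(1) facet_witness.simps facet_normal_lift_Step[OF 1(2)]
        by (simp add: step_seq_def half_seq_0 field_simps)
    next
      case (2 k l)
      then show ?thesis unfolding 2(1) facet_witness.simps facet_normal_lift_Pair[OF 2(2)]
        using slack_pair_seq[OF 2(2)] by simp
    qed
    fix j assume j: "j \<in> facet_indices n" "j \<noteq> i"
    then consider r where "j = Step r" "r \<in> {1..<n}" | k l where "j = Block k l" "(k, l) \<in> facet_pairs n"
      by (auto simp: facet_indices_def)
    then show "facet_normal j \<bullet> facet_witness i \<le> facet_bound j"
    proof cases
      case (1 r)
      show ?thesis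
      proof (cases rule: i_cases)
        case (1 q)
        have "r \<noteq> q" using j 1 \<open>j = Step r\<close> by simp
        then show ?thesis unfolding 1(1) \<open>j = Step r\<close> facet_witness.simps facet_normal_lift_Step[OF \<open>r \<in> {1..<n}\<close>]
          using 1 \<open>r \<in> {1..<n}\<close> by (auto simp: step_seq_def half_seq_0 field_simps)
      next
        case (2 k l)
        then show ?thesis unfolding 2(1) \<open>j = Step r\<close> facet_witness.simps facet_normal_lift_Step[OF \<open>r \<in> {1..<n}\<close>]
          using pair_seq_decreasing[OF 2(2) \<open>r \<in> {1..<n}\<close>] by simp
      qed
    next
      case (2 k l)
      note jkl = this
      show ?thesis
      proof (cases rule: i_cases)
        case (1 q)
        then show ?thesis unfolding 1(1) jkl(1) facet_witness.simps facet_normal_lift_Pair[OF jkl(2)]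
          using slack_step_seq[OF jkl(2)] by simp
      next
        case (2 k' l')
        show ?thesis unfolding 2(1) jkl(1) facet_witness.simps facet_normal_lift_Pair[OF jkl(2)]
          using slack_pair_seq_other[OF 2(2) jkl(2)] j(2) jkl(1) 2(1) by auto
      qed
    qed
  qed
  \<comment> \<open>The \<open>n - 1\<close> monotonicity steps turn
    \<open>(n^2 - 5n + 14) / 2\<close> into \<open>(n^2 - 3n + 12) / 2\<close>.\<close>
  also have "card (facet_indices n) = (n - 1) + card (facet_pairs n)"
  proof -
    have "inj_on Step {1..<n}" "inj_on (\<lambda>(k, l). Block k l) (facet_pairs n)"
      by (auto simp: inj_on_def)
    then have "card (Step ` {1..<n}) = n - 1"
      "card ((\<lambda>(k, l). Block k l) ` facet_pairs n) = card (facet_pairs n)"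
      by (simp_all add: card_image)
    then show ?thesis
      unfolding facet_indices_def using card_facet_pairs[OF n4]
      by (subst card_Un_disjoint) auto
  qed
  finally show ?thesis
    using card_facet_pairs[OF n4] n4 by (simp add: of_nat_diff field_simps power2_eq_square)
qed

lemma polytope_F_polytope: "polytope (F_polytope e)"
proof -
  have "F_polytope e = \<Inter> ((\<lambda>i. {x. facet_normal i \<bullet> x \<le> facet_bound i}) ` facet_indices n)"
    unfolding F_polytope_eq_halfspaces by auto
  moreover have "finite (facet_indices n)"
    using card_facet_pairs[OF n4] by (simp add: facet_indices_def)
  ultimately have "polyhedron (F_polytope e)"
    by (auto intro!: polyhedron_Inter polyhedron_halfspace_le)
  moreover have "bounded (F_polytope e)"
    unfolding F_polytope_eq_slice using compact_slice compact_imp_bounded by blast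
  ultimately show ?thesis by (simp add: polytope_eq_bounded_polyhedron)
qed

end

theorem theorem1p4:
  fixes e :: "nat \<Rightarrow> 'n::finite" and n :: nat
  assumes "CARD('n) = n" and "n \<ge> 4"
    and "bij_betw e {1..n} (UNIV :: 'n set)"
  shows "polytope (F_polytope e)
    \<and> card {v. v extreme_point_of F_polytope e} = 2 ^ (n - 1)
    \<and> card {E. E edge_of F_polytope e} = 2 ^ (n - 2) * (2 * n - 3)
    \<and> real (card {G. G facet_of F_polytope e}) = (real n ^ 2 - 3 * real n + 12) / 2"
proof -
  interpret coordinates e n using assms by unfold_locales auto
  show ?thesis
    using polytope_F_polytope card_facets_F_polytope n4
      finite_card_extreme_points_slice[OF inj_e, of 0 "\<lambda>_. 0"]
      finite_card_edges_slice[OF inj_e, of 0 "\<lambda>_. 0"]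
    by (simp add: F_polytope_eq_slice)
qed

end
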